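(* There is a polynomial $p$ such that every CQ ${\boldsymbol q}$ and every ontology $\mathcal{T}$ of depth $1$ have an NDL-rewriting of size at most $p(|{\boldsymbol q}|+|\mathcal{T}|)$; that is, any CQ and ontology of depth $1$ have a polynomial-size NDL-rewriting.
   Context: An ontology $\mathcal{T}$ is a finite set of tuple-generating dependencies (tgds) $\forall \vec{x}\,(\varphi(\vec{x}) \to \exists \vec{y} \bigwedge_i \psi_i(\vec{x},\vec{y}))$, where $\varphi$ and the $\psi_i$ are unary or binary atoms without constants and $|\vec{x}\cup\vec{y}|\le 2$; $|\mathcal{T}|$ is the number of predicate occurrences in $\mathcal{T}$. A data instance $\mathcal{A}$ is a finite set of ground atoms; $\mathsf{ind}(\mathcal{A})$ is its set of constants. $\mathcal{A}$ is complete (for $\mathcal{T}$) if for every ground atom $S(\vec{a})$ with $\vec{a}\subseteq\mathsf{ind}(\mathcal{A})$, $\mathcal{T},\mathcal{A}\models S(\vec{a})$ implies $S(\vec{a})\in\mathcal{A}$. A conjunctive query (CQ) ${\boldsymbol q}(\vec{x})=\exists\vec{y}\,\varphi(\vec{x},\vec{y})$ has $\varphi$ a conjunction of unary or binary atoms over the variables $\vec{x}\cup\vec{y}$ (no constants); $|{\boldsymbol q}|$ is its number of atoms. $\mathcal{T},\mathcal{A}\models{\boldsymbol q}(\vec{a})$ means ${\boldsymbol q}(\vec{a})$ holds in every model of $\mathcal{T}\cup\mathcal{A}$. A nonrecursive datalog (NDL) program is a finite set of Horn clauses $\gamma_0\leftarrow\gamma_1\land\dots\land\gamma_m$ (atoms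 over variables, every head variable occurs in the body) whose predicate dependency relation (head predicate depends on body predicates) is acyclic. An NDL-rewriting of ${\boldsymbol q}(\vec{x})$ and $\mathcal{T}$ is a pair $(\Pi,{\boldsymbol q}')$ of an NDL program $\Pi$ and an atom ${\boldsymbol q}'(\vec{x})$ such that for every complete data instance $\mathcal{A}$ and every tuple $\vec{a}\subseteq\mathsf{ind}(\mathcal{A})$: $\mathcal{T},\mathcal{A}\models{\boldsymbol q}(\vec{a})$ iff $\Pi,\mathcal{A}\models{\boldsymbol q}'(\vec{a})$. Its size is the size of $\Pi$. For a knowledge base $(\mathcal{T},\mathcal{A})$ there is a canonical model (chase) $\mathcal{C}_{\mathcal{T},\mathcal{A}}$ whose domain consists of $\mathsf{ind}(\mathcal{A})$ and labelled nulls introduced by the existential quantifiers. For a formula $\varrho(x)$ of the form $S(x)$, $S(x,x)$, $\exists y\,S(x,y)$ or $\exists y\,S(y,x)$ with $S$ a predicate of $\mathcal{T}$, $\mathcal{C}_\mathcal{T}^{\varrho(a)}$ denotes the canonical model of $(\mathcal{T}\cup\{A(x)\to\varrho(x)\},\{A(a)\})$ with $A$ a fresh unary predicate. $\mathcal{T}$ is of depth $k$ ($1\le k<\omega$) if some $\mathcal{C}_\mathcal{T}^{\varrho(a)}$ contains a chain $R_0(w_0,w_1),\dots,R_{k-1}(w_{k-1},w_k)$ (the $w_i$ not necessarily distinct) but no $\mathcal{C}_\mathcal{T}^{\varrho(a)}$ contains such a chain of greater length.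
   Formalization: As worded no ontology has finite depth (S(a,a) gives endless chains), so chains here follow null generation: each next element is a null introduced at the previous one or a loop at a null, predicates read either way; answer variables must be distinct and occur in the query. *)

theory Defs
  imports "HOL-Library.Countable" "HOL-Computational_Algebra.Polynomial"
begin

section \<open>Syntax\<close>

text \<open>Predicate names, variables and constants are natural numbers. A predicate is a name together
  with an arity, the arity being the length of the argument list; hence the same name used with two
  different arities denotes two different predicates.\<close>

datatype ('p, 't) atom = Atom (pname: 'p) (args: "'t list")

abbreviation arity :: "('p, 't) atom \<Rightarrow> nat" where
  "arity \<alpha> \<equiv> length (args \<alpha>)"

abbreviation vars :: "('p, 't) atom \<Rightarrow> 't set" where
  "vars \<alpha> \<equiv> set (args \<alpha>)"

abbreviation predicate :: "('p, 't) atom \<Rightarrow> 'p \<times> nat" where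
  "predicate \<alpha> \<equiv> (pname \<alpha>, arity \<alpha>)"

abbreviation subst :: "('s \<Rightarrow> 't) \<Rightarrow> ('p, 's) atom \<Rightarrow> ('p, 't) atom" where
  "subst h \<equiv> map_atom id h"

type_synonym data = "(nat, nat) atom set"

definition ind :: "data \<Rightarrow> nat set" where
  "ind A = (\<Union>\<alpha>\<in>A. set (args \<alpha>))"

text \<open>The universally quantified variables of a tgd are those of its body; every other variable of
  its head is existentially quantified.\<close>

datatype tgd = Tgd (body: "(nat, nat) atom") (head: "(nat, nat) atom list")

definition head_vars :: "tgd \<Rightarrow> nat set" where
  "head_vars \<tau> = (\<Union>\<psi>\<in>set (head \<tau>). vars \<psi>)"

definition is_tgd :: "tgd \<Rightarrow> bool" where
  "is_tgd \<tau> \<longleftrightarrow> (\<forall>\<alpha>\<in>insert (body \<tau>) (set (head \<tau>)). arity \<alpha> \<in> {1, 2}) \<and>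
     card (vars (body \<tau>) \<union> head_vars \<tau>) \<le> 2"

definition is_ontology :: "tgd set \<Rightarrow> bool" where
  "is_ontology T \<longleftrightarrow> finite T \<and> (\<forall>\<tau>\<in>T. is_tgd \<tau>)"

definition ontology_size :: "tgd set \<Rightarrow> nat" where
  "ontology_size T = (\<Sum>\<tau>\<in>T. 1 + length (head \<tau>))"

definition ontology_predicates :: "tgd set \<Rightarrow> (nat \<times> nat) set" where
  "ontology_predicates T = (\<Union>\<tau>\<in>T. predicate ` insert (body \<tau>) (set (head \<tau>)))"

text \<open>\<open>Cq xs \<phi>s\<close> is the query with answer variables \<open>xs\<close>; all other variables of \<open>\<phi>s\<close> are
  existentially quantified.\<close>

datatype cq = Cq (answer_vars: "nat list") (cq_atoms: "(nat, nat) atom list")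

definition is_cq :: "cq \<Rightarrow> bool" where
  "is_cq q \<longleftrightarrow> (\<forall>\<alpha>\<in>set (cq_atoms q). arity \<alpha> \<in> {1, 2}) \<and>
     distinct (answer_vars q) \<and> set (answer_vars q) \<subseteq> (\<Union>\<alpha>\<in>set (cq_atoms q). vars \<alpha>)"

definition cq_size :: "cq \<Rightarrow> nat" where
  "cq_size q = length (cq_atoms q)"

section \<open>Semantics\<close>

record ('p, 'd) interp =
  Dom :: "'d set"
  Con :: "nat \<Rightarrow> 'd"
  Rel :: "'p \<Rightarrow> 'd list set"

definition is_interp :: "('p, 'd) interp \<Rightarrow> bool" where
  "is_interp M \<longleftrightarrow> Dom M \<noteq> {} \<and> range (Con M) \<subseteq> Dom M \<and> (\<forall>P. Rel M P \<subseteq> lists (Dom M))"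

definition holds :: "('p, 'd) interp \<Rightarrow> ('t \<Rightarrow> 'd) \<Rightarrow> ('p, 't) atom \<Rightarrow> bool" where
  "holds M h \<alpha> \<longleftrightarrow> map h (args \<alpha>) \<in> Rel M (pname \<alpha>)"

definition sat_data :: "('p, 'd) interp \<Rightarrow> ('p, nat) atom set \<Rightarrow> bool" where
  "sat_data M A \<longleftrightarrow> (\<forall>\<alpha>\<in>A. holds M (Con M) \<alpha>)"

definition sat_tgd :: "(nat, 'd) interp \<Rightarrow> tgd \<Rightarrow> bool" where
  "sat_tgd M \<tau> \<longleftrightarrow> (\<forall>h. range h \<subseteq> Dom M \<and> holds M h (body \<tau>) \<longrightarrow>
     (\<exists>h'. range h' \<subseteq> Dom M \<and> (\<forall>x\<in>vars (body \<tau>). h' x = h x) \<and>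
           (\<forall>\<psi>\<in>set (head \<tau>). holds M h' \<psi>)))"

definition sat_cq :: "(nat, 'd) interp \<Rightarrow> cq \<Rightarrow> 'd list \<Rightarrow> bool" where
  "sat_cq M q ds \<longleftrightarrow> (\<exists>h. range h \<subseteq> Dom M \<and> map h (answer_vars q) = ds \<and>
     (\<forall>\<alpha>\<in>set (cq_atoms q). holds M h \<alpha>))"

text \<open>HOL cannot quantify over the type of the domain inside a definition, so models are taken with
  an arbitrary nonempty domain \<^emph>\<open>included in\<close> \<^typ>\<open>nat\<close>. The lemmas \<open>entails_cqD\<close>, \<open>entails_atomD\<close> and
  \<open>datalog_entailsD\<close> below show that this does not change entailment: what is entailed holds in
  models over every type.\<close>

definition entails_cq :: "tgd set \<Rightarrow> data \<Rightarrow> cq \<Rightarrow> nat list \<Rightarrow> bool" where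
  "entails_cq T A q as \<longleftrightarrow> (\<forall>M :: (nat, nat) interp.
     is_interp M \<and> (\<forall>\<tau>\<in>T. sat_tgd M \<tau>) \<and> sat_data M A \<longrightarrow> sat_cq M q (map (Con M) as))"

definition entails_atom :: "tgd set \<Rightarrow> data \<Rightarrow> (nat, nat) atom \<Rightarrow> bool" where
  "entails_atom T A \<alpha> \<longleftrightarrow> (\<forall>M :: (nat, nat) interp.
     is_interp M \<and> (\<forall>\<tau>\<in>T. sat_tgd M \<tau>) \<and> sat_data M A \<longrightarrow> holds M (Con M) \<alpha>)"

definition complete_for :: "tgd set \<Rightarrow> data \<Rightarrow> bool" where
  "complete_for T A \<longleftrightarrow>
     (\<forall>\<alpha>. set (args \<alpha>) \<subseteq> ind A \<and> entails_atom T A \<alpha> \<longrightarrow> \<alpha> \<in> A)"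

section \<open>Nonrecursive datalog rewritings\<close>

text \<open>Besides the predicates of the data (\<open>Sig\<close>), a program may use auxiliary predicates (\<open>Aux\<close>),
  which by typing do not occur in ontologies, queries or data instances.\<close>

datatype ndl_name = Sig nat | Aux nat

datatype clause = Clause (chead: "(ndl_name, nat) atom") (cbody: "(ndl_name, nat) atom list")

definition dependency :: "clause set \<Rightarrow> ((ndl_name \<times> nat) \<times> (ndl_name \<times> nat)) set" where
  "dependency \<Pi> = {(predicate (chead c), predicate \<beta>) | c \<beta>. c \<in> \<Pi> \<and> \<beta> \<in> set (cbody c)}"

definition is_ndl :: "clause set \<Rightarrow> bool" where
  "is_ndl \<Pi> \<longleftrightarrow> finite \<Pi> \<and>
     (\<forall>c\<in>\<Pi>. vars (chead c) \<subseteq> (\<Union>\<beta>\<in>set (cbody c). vars \<beta>)) \<and>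
     acyclic (dependency \<Pi>)"

text \<open>The size of a program is the number of occurrences of predicates and variables in it.\<close>

definition ndl_size :: "clause set \<Rightarrow> nat" where
  "ndl_size \<Pi> = (\<Sum>c\<in>\<Pi>. \<Sum>\<alpha>\<leftarrow>chead c # cbody c. 1 + arity \<alpha>)"

definition sat_clause :: "(ndl_name, 'd) interp \<Rightarrow> clause \<Rightarrow> bool" where
  "sat_clause M c \<longleftrightarrow> (\<forall>h. range h \<subseteq> Dom M \<and> (\<forall>\<beta>\<in>set (cbody c). holds M h \<beta>) \<longrightarrow>
     holds M h (chead c))"

definition datalog_entails :: "clause set \<Rightarrow> data \<Rightarrow> (ndl_name, nat) atom \<Rightarrow> bool" where
  "datalog_entails \<Pi> A \<alpha> \<longleftrightarrow> (\<forall>M :: (ndl_name, nat) interp.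
     is_interp M \<and> (\<forall>c\<in>\<Pi>. sat_clause M c) \<and> sat_data M (map_atom Sig id ` A) \<longrightarrow>
     holds M (Con M) \<alpha>)"

text \<open>The goal atom is \<open>G\<close> applied to the answer variables of \<open>q\<close>.\<close>

definition ndl_rewriting :: "cq \<Rightarrow> tgd set \<Rightarrow> clause set \<Rightarrow> ndl_name \<Rightarrow> bool" where
  "ndl_rewriting q T \<Pi> G \<longleftrightarrow> is_ndl \<Pi> \<and>
     (\<forall>A as. finite A \<and> complete_for T A \<and>
        set as \<subseteq> ind A \<and> length as = length (answer_vars q) \<longrightarrow>
        (entails_cq T A q as \<longleftrightarrow> datalog_entails \<Pi> A (Atom G as)))"

section \<open>Canonical models and depth\<close>

text \<open>\<open>Null \<tau> e\<close> is the labelled null introduced by applying \<open>\<tau>\<close> at the element \<open>e\<close>. As a tgd has at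
  most two variables, one that has an existential variable has exactly one of them and exactly one
  body variable, so this identifies the null.\<close>

datatype elem = Ind nat | Null tgd elem

definition full :: "tgd \<Rightarrow> bool" where
  "full \<tau> \<longleftrightarrow> head_vars \<tau> \<subseteq> vars (body \<tau>)"

inductive_set full_closure :: "tgd set \<Rightarrow> (nat, elem) atom set \<Rightarrow> (nat, elem) atom set"
  for T I where
  base: "\<alpha> \<in> I \<Longrightarrow> \<alpha> \<in> full_closure T I"
| step: "\<lbrakk>\<tau> \<in> T; full \<tau>; subst h (body \<tau>) \<in> full_closure T I; \<psi> \<in> set (head \<tau>)\<rbrakk>
    \<Longrightarrow> subst h \<psi> \<in> full_closure T I"

definition applicable :: "tgd set \<Rightarrow> (nat, elem) atom set \<Rightarrow> tgd \<Rightarrow> elem \<Rightarrow> bool" where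
  "applicable T I \<tau> e \<longleftrightarrow> \<tau> \<in> T \<and> \<not> full \<tau> \<and> subst (\<lambda>_. e) (body \<tau>) \<in> I \<and>
     \<not> (\<exists>h. (\<forall>x\<in>vars (body \<tau>). h x = e) \<and> (\<forall>\<psi>\<in>set (head \<tau>). subst h \<psi> \<in> I))"

definition apply_existential :: "tgd set \<Rightarrow> (nat, elem) atom set \<Rightarrow> (nat, elem) atom set" where
  "apply_existential T I =
     {subst (\<lambda>v. if v \<in> vars (body \<tau>) then e else Null \<tau> e) \<psi> | \<tau> e \<psi>.
        applicable T I \<tau> e \<and> \<psi> \<in> set (head \<tau>)}"

text \<open>The standard (restricted) chase: an existential tgd is applied only where its head is not yet
  satisfied, after saturation under the tgds without existential variables. The canonical model is
  given by the set of its atoms.\<close>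

primrec chase :: "tgd set \<Rightarrow> data \<Rightarrow> nat \<Rightarrow> (nat, elem) atom set" where
  "chase T A 0 = full_closure T (subst Ind ` A)"
| "chase T A (Suc n) = full_closure T (chase T A n \<union> apply_existential T (chase T A n))"

definition canonical_model :: "tgd set \<Rightarrow> data \<Rightarrow> (nat, elem) atom set" where
  "canonical_model T A = (\<Union>n. chase T A n)"

text \<open>The tgds \<open>A(x) \<rightarrow> \<rho>(x)\<close>, where \<open>\<rho>(x)\<close> is \<open>S(x)\<close>, \<open>S(x,x)\<close>, \<open>\<exists>y S(x,y)\<close> or \<open>\<exists>y S(y,x)\<close> for a
  predicate \<open>S\<close> of \<open>T\<close>.\<close>

definition root_tgds :: "tgd set \<Rightarrow> nat \<Rightarrow> tgd set" where
  "root_tgds T A =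
     {Tgd (Atom A [0]) [Atom S [0]] | S. (S, 1) \<in> ontology_predicates T} \<union>
     {Tgd (Atom A [0]) [Atom S ts] | S ts.
        (S, 2) \<in> ontology_predicates T \<and> ts \<in> {[0, 0], [0, 1], [1, 0]}}"

definition rooted_models :: "tgd set \<Rightarrow> (nat, elem) atom set set" where
  "rooted_models T =
     {canonical_model (insert \<rho> T) {Atom A [a]} | A a \<rho>.
        (A, 1) \<notin> ontology_predicates T \<and> \<rho> \<in> root_tgds T A}"

text \<open>A chain follows the generation of nulls: each \<open>w\<^sub>i\<^sub>+\<^sub>1\<close> is a labelled null that was introduced at
  \<open>w\<^sub>i\<close>, or is \<open>w\<^sub>i\<close> itself (a loop at a null, giving chains of unbounded length), and \<open>R\<^sub>i\<close> is a binary
  predicate or the inverse of one. Without the first restriction every atom \<open>S(a,a)\<close>, in particular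
  the one of the model for \<open>\<rho>(x) = S(x,x)\<close>, and every pair \<open>R(w,w')\<close>, \<open>S(w',w)\<close> would give chains of
  unbounded length, and no ontology would have a finite positive depth.\<close>

definition chain_step :: "(nat, elem) atom set \<Rightarrow> elem \<Rightarrow> elem \<Rightarrow> bool" where
  "chain_step C w w' \<longleftrightarrow> (\<exists>R. Atom R [w, w'] \<in> C \<or> Atom R [w', w] \<in> C) \<and>
     (\<exists>\<tau> e. w' = Null \<tau> e \<and> (w = e \<or> w = w'))"

definition has_chain :: "(nat, elem) atom set \<Rightarrow> nat \<Rightarrow> bool" where
  "has_chain C k \<longleftrightarrow> (\<exists>w :: nat \<Rightarrow> elem. \<forall>i<k. chain_step C (w i) (w (Suc i)))"

definition of_depth :: "tgd set \<Rightarrow> nat \<Rightarrow> bool" where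
  "of_depth T k \<longleftrightarrow> 1 \<le> k \<and> (\<exists>C\<in>rooted_models T. has_chain C k) \<and>
     (\<forall>C\<in>rooted_models T. \<forall>l>k. \<not> has_chain C l)"

section \<open>Independence of entailment from the type of the domain\<close>

instance atom :: (countable, countable) countable by countable_datatype
instance tgd :: countable by countable_datatype

text \<open>Terms naming a countable part of a model that contains the constants and is closed under
  witnesses for tgds.\<close>

datatype witness_term = WCon nat | WApp tgd "witness_term list" nat

instance witness_term :: countable by countable_datatype

lemma ex_witness_closed_enumeration:
  fixes M :: "(nat, 'd) interp"
  assumes "is_interp M" and T: "\<forall>\<tau>\<in>T. sat_tgd M \<tau>"
  obtains f :: "nat \<Rightarrow> 'd" where "range f \<subseteq> Dom M" "range (Con M) \<subseteq> range f"
    "\<And>\<tau> h. \<lbrakk>\<tau> \<in> T; holds M (\<lambda>x. f (h x)) (body \<tau>)\<rbrakk> \<Longrightarrow>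
       \<exists>h'. (\<forall>x\<in>vars (body \<tau>). f (h' x) = f (h x)) \<and> (\<forall>\<psi>\<in>set (head \<tau>). holds M (\<lambda>x. f (h' x)) \<psi>)"
proof -
  define good where "good \<tau> h h' \<longleftrightarrow> range h' \<subseteq> Dom M \<and> (\<forall>x\<in>vars (body \<tau>). h' x = h x) \<and>
      (\<forall>\<psi>\<in>set (head \<tau>). holds M h' \<psi>)" for \<tau> h h'
  define wit where "wit \<tau> h = (if \<exists>h'. good \<tau> h h' then SOME h'. good \<tau> h h' else (\<lambda>_. Con M 0))"
    for \<tau> h
  have con: "Con M c \<in> Dom M" for c
    using assms(1) by (auto simp: is_interp_def)
  have wit_dom: "wit \<tau> h x \<in> Dom M" for \<tau> h x
  proof (cases "\<exists>h'. good \<tau> h h'")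
    case True
    then have "good \<tau> h (wit \<tau> h)" unfolding wit_def by (simp add: someI_ex[of "good _ _"])
    then show ?thesis by (auto simp: good_def)
  qed (simp add: wit_def con)
  define ev where "ev = rec_witness_term (Con M)
      (\<lambda>\<tau> ps v. wit \<tau> (\<lambda>x. if x < length ps then snd (ps ! x) else Con M 0) v)"
  have ev_WCon: "ev (WCon c) = Con M c" for c by (simp add: ev_def)
  have ev_WApp: "ev (WApp \<tau> ts v) = wit \<tau> (\<lambda>x. if x < length ts then ev (ts ! x) else Con M 0) v" for \<tau> ts v
    unfolding ev_def by (simp cong: if_cong)
  have ev_dom: "ev t \<in> Dom M" for t
    by (cases t) (auto simp: ev_WCon ev_WApp con wit_dom)
  let ?f = "\<lambda>n. ev (from_nat n)"
  show thesis
  proof (rule that[of ?f])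
    show "range ?f \<subseteq> Dom M" using ev_dom by auto
    show "range (Con M) \<subseteq> range ?f"
      using ev_WCon by (auto intro!: image_eqI[of _ _ "to_nat (WCon _)"])
  next
    fix \<tau> h
    assume \<tau>: "\<tau> \<in> T" and bd: "holds M (\<lambda>x. ?f (h x)) (body \<tau>)"
    obtain m where m: "\<forall>x\<in>vars (body \<tau>). x < m"
      by (metis finite_nat_set_iff_bounded List.finite_set)
    define ts where "ts = map (\<lambda>x. from_nat (h x) :: witness_term) [0..<m]"
    define g where "g = (\<lambda>x. if x < length ts then ev (ts ! x) else Con M 0)"
    have g: "g x = ?f (h x)" if "x \<in> vars (body \<tau>)" for x
      using that m by (simp add: g_def ts_def)
    have "map g (args (body \<tau>)) = map (\<lambda>x. ?f (h x)) (args (body \<tau>))"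
      using g by simp
    then have "holds M g (body \<tau>)" using bd by (simp only: holds_def)
    moreover have "range g \<subseteq> Dom M" by (auto simp: g_def ev_dom con)
    ultimately have "\<exists>h'. good \<tau> g h'"
      using T \<tau> unfolding sat_tgd_def good_def by blast
    then have w: "good \<tau> g (wit \<tau> g)" unfolding wit_def by (simp add: someI_ex[of "good _ _"])
    have e: "ev (WApp \<tau> ts x) = wit \<tau> g x" for x
      by (simp add: ev_WApp g_def)
    show "\<exists>h'. (\<forall>x\<in>vars (body \<tau>). ?f (h' x) = ?f (h x)) \<and>
        (\<forall>\<psi>\<in>set (head \<tau>). holds M (\<lambda>x. ?f (h' x)) \<psi>)"
      using w g by (intro exI[of _ "\<lambda>x. to_nat (WApp \<tau> ts x)"]) (simp add: e good_def)
  qed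
qed

definition pullback :: "('p, 'd) interp \<Rightarrow> (nat \<Rightarrow> 'd) \<Rightarrow> ('p, nat) interp" where
  "pullback M f = \<lparr>Dom = UNIV, Con = (\<lambda>c. SOME n. f n = Con M c),
     Rel = (\<lambda>P. {ns. map f ns \<in> Rel M P})\<rparr>"

lemma holds_pullback: "holds (pullback M f) h \<alpha> \<longleftrightarrow> holds M (\<lambda>x. f (h x)) \<alpha>"
  by (simp add: holds_def pullback_def comp_def)

lemma pullback_facts:
  assumes "range (Con M) \<subseteq> range f"
  shows "is_interp (pullback M f)" "f (Con (pullback M f) c) = Con M c" "Dom (pullback M f) = UNIV"
    "sat_data (pullback M f) A \<longleftrightarrow> sat_data M A"
proof -
  have c: "f (Con (pullback M f) c) = Con M c" for c
  proof -
    have "\<exists>n. f n = Con M c" using assms by (metis rangeE rangeI subsetD)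
    then show ?thesis unfolding pullback_def by simp (rule someI_ex)
  qed
  then show "f (Con (pullback M f) c) = Con M c" .
  show "is_interp (pullback M f)" "Dom (pullback M f) = UNIV"
    by (auto simp: is_interp_def pullback_def)
  show "sat_data (pullback M f) A \<longleftrightarrow> sat_data M A"
    by (simp add: sat_data_def holds_pullback c)
qed

lemma ex_countable_model:
  fixes M :: "(nat, 'd) interp"
  assumes "is_interp M" "\<forall>\<tau>\<in>T. sat_tgd M \<tau>"
  obtains f :: "nat \<Rightarrow> 'd" where "range f \<subseteq> Dom M" "range (Con M) \<subseteq> range f"
    "\<forall>\<tau>\<in>T. sat_tgd (pullback M f) \<tau>"
proof -
  obtain f :: "nat \<Rightarrow> 'd" where f: "range f \<subseteq> Dom M" "range (Con M) \<subseteq> range f"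
    "\<And>\<tau> h. \<lbrakk>\<tau> \<in> T; holds M (\<lambda>x. f (h x)) (body \<tau>)\<rbrakk> \<Longrightarrow>
       \<exists>h'. (\<forall>x\<in>vars (body \<tau>). f (h' x) = f (h x)) \<and> (\<forall>\<psi>\<in>set (head \<tau>). holds M (\<lambda>x. f (h' x)) \<psi>)"
    using ex_witness_closed_enumeration[OF assms] by metis
  have "sat_tgd (pullback M f) \<tau>" if "\<tau> \<in> T" for \<tau>
    unfolding sat_tgd_def holds_pullback pullback_facts(3)[OF f(2)]
  proof (intro allI impI)
    fix h :: "nat \<Rightarrow> nat"
    assume "range h \<subseteq> UNIV \<and> holds M (\<lambda>x. f (h x)) (body \<tau>)"
    then obtain h' where h': "\<forall>x\<in>vars (body \<tau>). f (h' x) = f (h x)"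
      "\<forall>\<psi>\<in>set (head \<tau>). holds M (\<lambda>x. f (h' x)) \<psi>"
      using f(3)[OF \<open>\<tau> \<in> T\<close>] by blast
    define k where "k x = (if x \<in> vars (body \<tau>) then h x else h' x)" for x
    have "(\<lambda>x. f (k x)) = (\<lambda>x. f (h' x))" using h'(1) by (auto simp: k_def)
    then show "\<exists>h'. range h' \<subseteq> UNIV \<and> (\<forall>x\<in>vars (body \<tau>). h' x = h x) \<and>
        (\<forall>\<psi>\<in>set (head \<tau>). holds M (\<lambda>x. f (h' x)) \<psi>)"
      using h'(2) by (intro exI[of _ k]) (simp add: k_def)
  qed
  then show thesis using that f(1,2) by blast
qed

lemma entails_cqD:
  fixes M :: "(nat, 'd) interp"
  assumes "entails_cq T A q as" and M: "is_interp M" "\<forall>\<tau>\<in>T. sat_tgd M \<tau>" "sat_data M A"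
  shows "sat_cq M q (map (Con M) as)"
proof -
  obtain f :: "nat \<Rightarrow> 'd" where f: "range f \<subseteq> Dom M" "range (Con M) \<subseteq> range f"
    "\<forall>\<tau>\<in>T. sat_tgd (pullback M f) \<tau>"
    using ex_countable_model[OF M(1,2)] by metis
  have "sat_cq (pullback M f) q (map (Con (pullback M f)) as)"
    using assms(1) M(3) f(3) unfolding entails_cq_def by (simp add: pullback_facts[OF f(2)])
  then obtain h where h: "map h (answer_vars q) = map (Con (pullback M f)) as"
    "\<forall>\<alpha>\<in>set (cq_atoms q). holds M (\<lambda>x. f (h x)) \<alpha>"
    unfolding sat_cq_def holds_pullback by blast
  have "map (\<lambda>x. f (h x)) (answer_vars q) = map f (map h (answer_vars q))" by simp
  also have "\<dots> = map (Con M) as" unfolding h(1) by (simp add: pullback_facts[OF f(2)])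
  finally show ?thesis
    using h(2) f(1) unfolding sat_cq_def by (intro exI[of _ "\<lambda>x. f (h x)"]) auto
qed

lemma entails_atomD:
  fixes M :: "(nat, 'd) interp"
  assumes "entails_atom T A \<alpha>" and M: "is_interp M" "\<forall>\<tau>\<in>T. sat_tgd M \<tau>" "sat_data M A"
  shows "holds M (Con M) \<alpha>"
proof -
  obtain f :: "nat \<Rightarrow> 'd" where f: "range f \<subseteq> Dom M" "range (Con M) \<subseteq> range f"
    "\<forall>\<tau>\<in>T. sat_tgd (pullback M f) \<tau>"
    using ex_countable_model[OF M(1,2)] by metis
  have "holds (pullback M f) (Con (pullback M f)) \<alpha>"
    using assms(1) M(3) f(3) unfolding entails_atom_def by (simp add: pullback_facts[OF f(2)])
  then show ?thesis by (simp add: holds_pullback pullback_facts[OF f(2)])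
qed

lemma datalog_entailsD:
  fixes M :: "(ndl_name, 'd) interp"
  assumes "datalog_entails \<Pi> A \<alpha>" and M: "is_interp M" "\<forall>c\<in>\<Pi>. sat_clause M c"
    "sat_data M (map_atom Sig id ` A)"
  shows "holds M (Con M) \<alpha>"
proof -
  have con: "range (Con M) \<subseteq> range (Con M)" ..
  have "sat_clause (pullback M (Con M)) c" if "c \<in> \<Pi>" for c
    unfolding sat_clause_def holds_pullback
  proof (intro allI impI)
    fix h :: "nat \<Rightarrow> nat"
    assume "range h \<subseteq> Dom (pullback M (Con M)) \<and> (\<forall>\<beta>\<in>set (cbody c). holds M (\<lambda>x. Con M (h x)) \<beta>)"
    moreover have "range (\<lambda>x. Con M (h x)) \<subseteq> Dom M" using M(1) by (auto simp: is_interp_def)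
    ultimately show "holds M (\<lambda>x. Con M (h x)) (chead c)"
      using M(2) that unfolding sat_clause_def by blast
  qed
  then have "holds (pullback M (Con M)) (Con (pullback M (Con M))) \<alpha>"
    using assms(1) M(3) unfolding datalog_entails_def by (simp add: pullback_facts[OF con])
  then show ?thesis by (simp add: holds_pullback pullback_facts[OF con])
qed

end

theory Submission
  imports Defs
begin

text \<open>In depth 1 a null attached to an individual \<open>a\<close> has no neighbour but \<open>a\<close> and carries no loop. Hence
  every tree witness with a root consists of a single existential variable \<open>y\<close> mapped to a null, all of
  whose neighbours are mapped to one individual; all other matches into nulls are matches of whole
  connected components of the query. Fix the values of the variables mapped to individuals. It remains
  to choose an independent set \<open>I\<close> of witnessed variables that meets every atom which does not hold on
  its own. As atoms have at most two variables, this is an instance of 2-SAT whose clauses disappear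
  when more data are present. It is satisfiable iff no variable lies on a cycle of the implication graph
  through both of its literals, and non-reachability in that graph is computed by a monotone circuit
  of polynomial size, which is an NDL program whose predicates carry all variables of the query.\<close>

section \<open>The chase\<close>

text \<open>The depth condition speaks only of models rooted at one atom. So the model in which the
  query is evaluated is not the chase of the data: disjoint copies of the rooted models of
  \<open>S(a)\<close> and \<open>S(a,a)\<close> are glued onto the complete data at their roots.
  Every null then lies in one copy, where both the tree shape and the depth bound apply. Chains
  follow binary atoms only, so nulls that no binary atom joins to their parent can be nested deeper
  even in depth 1. Components of the query that touch no individual are therefore handled by an
  entailment test from a single atom, not by listing nulls. This test and the one for tree witnesses
  do not mention the data. They are settled when the program is written, and as only its size is
  measured they need not be effective. A component entailed in this way never competes with choices
  made elsewhere, so its atoms count as holding on their own. What remains is the choice among tree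
  witnesses; listing all independent sets would be exponential, which is why satisfiability is
  decided inside the program.\<close>

lemma args_subst [simp]: "args (subst h \<alpha>) = map h (args \<alpha>)"
  and pname_subst [simp]: "pname (subst h \<alpha>) = pname \<alpha>"
  by (simp_all add: atom.map_sel)

lemma subst_cong: "(\<And>x. x \<in> vars \<alpha> \<Longrightarrow> f x = g x) \<Longrightarrow> subst f \<alpha> = subst g \<alpha>"
  by (cases \<alpha>) auto

lemma subst_subst [simp]: "subst f (subst g \<alpha>) = subst (\<lambda>x. f (g x)) \<alpha>"
  by (cases \<alpha>) auto

lemma holds_subst [simp]: "holds M f (subst g \<alpha>) \<longleftrightarrow> holds M (\<lambda>x. f (g x)) \<alpha>"
  by (simp add: holds_def comp_def)

lemma holds_cong: "(\<And>x. x \<in> vars \<alpha> \<Longrightarrow> f x = g x) \<Longrightarrow> holds M f \<alpha> \<longleftrightarrow> holds M g \<alpha>"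
  by (simp add: holds_def cong: map_cong)

text \<open>Arities are positive, so the body has a variable; the bound of two variables then leaves
  room for one body variable and one existential variable. Hence a trigger of such a tgd is a single
  element, as \<open>Null\<close> presupposes.\<close>

lemma nonfull_tgd_vars:
  assumes "is_tgd \<tau>" "\<not> full \<tau>"
  obtains x y where "vars (body \<tau>) = {x}" "y \<noteq> x" "y \<in> head_vars \<tau>" "head_vars \<tau> \<subseteq> {x, y}"
proof -
  obtain y where y: "y \<in> head_vars \<tau>" "y \<notin> vars (body \<tau>)"
    using assms(2) by (auto simp: full_def)
  have "args (body \<tau>) \<noteq> []"
    using assms(1) by (auto simp: is_tgd_def)
  then obtain x where x: "x \<in> vars (body \<tau>)"
    by (metis all_not_in_conv set_empty)
  have fin: "finite (vars (body \<tau>) \<union> head_vars \<tau>)"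
    by (simp add: head_vars_def)
  have xy: "x \<noteq> y" using x y by auto
  have "{x, y} = vars (body \<tau>) \<union> head_vars \<tau>"
    using assms(1) x y xy fin by (intro card_seteq) (auto simp: is_tgd_def)
  then show thesis using x y xy by (intro that[of x y]) auto
qed

lemma chase_full_step:
  assumes "\<tau> \<in> T" "full \<tau>" "subst h (body \<tau>) \<in> chase T A n" "\<psi> \<in> set (head \<tau>)"
  shows "subst h \<psi> \<in> chase T A n"
  using assms by (cases n) (auto intro: full_closure.step)

text \<open>Fairness is built in: a body is one atom, so a trigger appears at a finite stage, full
  tgds are saturated within each stage, and the next stage applies every existential tgd whose head
  is still missing there.\<close>

lemma canonical_model_closed:
  assumes T: "\<forall>\<tau>\<in>T. is_tgd \<tau>" and \<tau>: "\<tau> \<in> T" and bd: "subst h (body \<tau>) \<in> canonical_model T A"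
  shows "\<exists>h'. (\<forall>x\<in>vars (body \<tau>). h' x = h x) \<and>
    (\<forall>\<psi>\<in>set (head \<tau>). subst h' \<psi> \<in> canonical_model T A)"
proof -
  obtain n where n: "subst h (body \<tau>) \<in> chase T A n"
    using bd by (auto simp: canonical_model_def)
  have sub: "chase T A m \<subseteq> canonical_model T A" for m by (auto simp: canonical_model_def)
  show ?thesis
  proof (cases "full \<tau>")
    case True
    then show ?thesis using chase_full_step[OF \<tau> True n] sub by blast
  next
    case False
    then obtain x where x: "vars (body \<tau>) = {x}" using nonfull_tgd_vars T \<tau> by metis
    then have eq: "subst h (body \<tau>) = subst (\<lambda>_. h x) (body \<tau>)" by (intro subst_cong) auto
    show ?thesis
    proof (cases "applicable T (chase T A n) \<tau> (h x)")
      case True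
      let ?h = "\<lambda>v. if v \<in> vars (body \<tau>) then h x else Null \<tau> (h x)"
      have "subst ?h \<psi> \<in> chase T A (Suc n)" if "\<psi> \<in> set (head \<tau>)" for \<psi>
        unfolding chase.simps
        by (rule full_closure.base) (use True that in \<open>auto simp: apply_existential_def\<close>)
      then have "subst ?h \<psi> \<in> canonical_model T A" if "\<psi> \<in> set (head \<tau>)" for \<psi>
        using that subsetD[OF sub[of "Suc n"]] by blast
      then show ?thesis using x by (intro exI[of _ ?h]) simp
    next
      case False
      then obtain h' where "\<forall>v\<in>vars (body \<tau>). h' v = h x" "\<forall>\<psi>\<in>set (head \<tau>). subst h' \<psi> \<in> chase T A n"
        using \<open>\<not> full \<tau>\<close> \<tau> n eq unfolding applicable_def by metis
      then show ?thesis using x subsetD[OF sub[of n]] by (intro exI[of _ h']) simp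
    qed
  qed
qed

lemma full_closure_holds:
  assumes "\<forall>\<tau>\<in>T. sat_tgd M \<tau>" "range f \<subseteq> Dom M" "\<And>\<alpha>. \<alpha> \<in> I \<Longrightarrow> holds M f \<alpha>"
    and "\<alpha> \<in> full_closure T I"
  shows "holds M f \<alpha>"
  using assms(4)
proof induction
  case (step \<tau> h \<psi>)
  have "holds M (\<lambda>x. f (h x)) (body \<tau>)" "range (\<lambda>x. f (h x)) \<subseteq> Dom M"
    using step assms(2) by auto
  then obtain h' where h': "\<forall>x\<in>vars (body \<tau>). h' x = f (h x)" "\<forall>\<psi>\<in>set (head \<tau>). holds M h' \<psi>"
    using bspec[OF assms(1) step.hyps(1)] unfolding sat_tgd_def by blast
  have "holds M h' \<psi> \<longleftrightarrow> holds M (\<lambda>x. f (h x)) \<psi>"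
  proof (intro holds_cong)
    fix x assume "x \<in> vars \<psi>"
    then have "x \<in> vars (body \<tau>)" using step.hyps(2,4) unfolding full_def head_vars_def by blast
    then show "h' x = f (h x)" using h'(1) by blast
  qed
  then show ?case using h' step.hyps by simp
qed (use assms in blast)

text \<open>Universality of the restricted chase. The image of \<open>Null \<tau> e\<close> depends
  only on \<open>\<tau>\<close> and the image of \<open>e\<close>, so one recursion on elements
  yields a map that serves all stages at once, whenever a null is created.\<close>

lemma canonical_model_hom:
  fixes M :: "(nat, 'd) interp"
  assumes T: "\<forall>\<tau>\<in>T. is_tgd \<tau>" and M: "is_interp M" "\<forall>\<tau>\<in>T. sat_tgd M \<tau>" "sat_data M A"
  obtains f where "\<And>c. f (Ind c) = Con M c" "range f \<subseteq> Dom M"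
    "\<And>\<alpha>. \<alpha> \<in> canonical_model T A \<Longrightarrow> holds M f \<alpha>"
proof -
  define good where "good \<tau> d d' \<longleftrightarrow> d' \<in> Dom M \<and>
    (\<forall>\<psi>\<in>set (head \<tau>). holds M (\<lambda>v. if v \<in> vars (body \<tau>) then d else d') \<psi>)" for \<tau> d d'
  \<comment> \<open>The default \<open>Con M 0\<close> serves only nulls that the chase never
    creates; \<open>f\<close> is total and must stay in the domain.\<close>
  define wit where "wit \<tau> d = (if \<exists>d'. good \<tau> d d' then SOME d'. good \<tau> d d' else Con M 0)" for \<tau> d
  define f where "f = rec_elem (Con M) (\<lambda>\<tau> e d. wit \<tau> d)"
  have f: "f (Ind c) = Con M c" "f (Null \<tau> e) = wit \<tau> (f e)" for c \<tau> e
    by (simp_all add: f_def)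
  have con: "Con M c \<in> Dom M" for c using M(1) by (auto simp: is_interp_def)
  have "wit \<tau> d \<in> Dom M" for \<tau> d
  proof (cases "\<exists>d'. good \<tau> d d'")
    case True
    then have "good \<tau> d (wit \<tau> d)" unfolding wit_def by (simp add: someI_ex[of "good _ _"])
    then show ?thesis by (simp add: good_def)
  qed (simp add: wit_def con)
  then have "f e \<in> Dom M" for e
    by (cases e) (simp_all add: f con)
  then have dom: "range f \<subseteq> Dom M" by auto
  have ex: "holds M f \<alpha>" if \<alpha>: "\<alpha> \<in> apply_existential T I" and I: "\<And>\<beta>. \<beta> \<in> I \<Longrightarrow> holds M f \<beta>" for \<alpha> I
  proof -
    obtain \<tau> e \<psi> where ap: "applicable T I \<tau> e" "\<psi> \<in> set (head \<tau>)"
      and \<alpha>: "\<alpha> = subst (\<lambda>v. if v \<in> vars (body \<tau>) then e else Null \<tau> e) \<psi>"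
      using \<alpha> by (auto simp: apply_existential_def)
    then have \<tau>: "\<tau> \<in> T" "\<not> full \<tau>" "subst (\<lambda>_. e) (body \<tau>) \<in> I" by (auto simp: applicable_def)
    obtain x y where xy: "vars (body \<tau>) = {x}" "y \<noteq> x" "head_vars \<tau> \<subseteq> {x, y}"
      using nonfull_tgd_vars T \<tau> by metis
    have "holds M (\<lambda>_. f e) (body \<tau>)" using I[OF \<tau>(3)] by simp
    moreover have "range (\<lambda>_::nat. f e) \<subseteq> Dom M" using dom by auto
    ultimately obtain h' where h': "range h' \<subseteq> Dom M" "h' x = f e" "\<forall>\<psi>\<in>set (head \<tau>). holds M h' \<psi>"
      using M(2) \<tau>(1) xy(1) unfolding sat_tgd_def by (metis insertI1)
    have "holds M (\<lambda>v. if v \<in> vars (body \<tau>) then f e else h' y) \<psi>" if "\<psi> \<in> set (head \<tau>)" for \<psi>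
    proof -
      have "holds M h' \<psi> \<longleftrightarrow> holds M (\<lambda>v. if v \<in> vars (body \<tau>) then f e else h' y) \<psi>"
        by (intro holds_cong) (use xy h'(2) that in \<open>auto simp: head_vars_def\<close>)
      then show ?thesis using h'(3) that by blast
    qed
    then have "good \<tau> (f e) (h' y)" using h'(1) by (auto simp: good_def)
    then have "good \<tau> (f e) (f (Null \<tau> e))" unfolding f wit_def by (auto intro: someI_ex[of "good _ _"])
    then have "holds M (\<lambda>v. if v \<in> vars (body \<tau>) then f e else f (Null \<tau> e)) \<psi>"
      using ap(2) unfolding good_def by blast
    then show ?thesis unfolding \<alpha> by (simp add: if_distrib[of f])
  qed
  have "\<alpha> \<in> chase T A n \<Longrightarrow> holds M f \<alpha>" for n \<alpha>
  proof (induction n arbitrary: \<alpha>)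
    case 0
    have "holds M f \<beta>" if "\<beta> \<in> subst Ind ` A" for \<beta>
      using M(3) that by (auto simp: sat_data_def f)
    then show ?case using 0 full_closure_holds[OF M(2) dom] by auto
  next
    case (Suc n)
    show ?case
    proof (rule full_closure_holds[OF M(2) dom])
      show "\<alpha> \<in> full_closure T (chase T A n \<union> apply_existential T (chase T A n))"
        using Suc.prems by simp
      show "holds M f \<beta>" if "\<beta> \<in> chase T A n \<union> apply_existential T (chase T A n)" for \<beta>
        using that Suc.IH ex[of \<beta> "chase T A n"] by blast
    qed
  qed
  then show thesis using f dom by (intro that[of f]) (auto simp: canonical_model_def)
qed

text \<open>Full tgds never enlarge the set of arguments of an atom, and an existential step uses an
  element and its own null only. So every atom lives on a parent and its child: the nulls form a
  forest whatever the direction of the binary atoms.\<close>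

lemma canonical_model_local:
  assumes T: "\<forall>\<tau>\<in>T. is_tgd \<tau>" and "\<alpha> \<in> canonical_model T {Atom P [c]}"
  shows "(\<exists>e \<tau>. vars \<alpha> \<subseteq> {e, Null \<tau> e}) \<and> (\<forall>a. Ind a \<in> vars \<alpha> \<longrightarrow> a = c)"
proof -
  let ?loc = "\<lambda>\<alpha> :: (nat, elem) atom. (\<exists>e \<tau>. vars \<alpha> \<subseteq> {e, Null \<tau> e}) \<and> (\<forall>a. Ind a \<in> vars \<alpha> \<longrightarrow> a = c)"
  have cl: "?loc \<alpha>" if "\<alpha> \<in> full_closure T I" "\<And>\<beta>. \<beta> \<in> I \<Longrightarrow> ?loc \<beta>" for \<alpha> I
    using that(1)
  proof induction
    case (step \<tau> h \<psi>)
    have "vars \<psi> \<subseteq> vars (body \<tau>)" using step.hyps by (auto simp: full_def head_vars_def)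
    then have "vars (subst h \<psi>) \<subseteq> vars (subst h (body \<tau>))" by auto
    then show ?case using step.IH by (meson order_trans subsetD)
  qed (use that in blast)
  have ex: "?loc \<alpha>" if \<alpha>: "\<alpha> \<in> apply_existential T I" and I: "\<And>\<beta>. \<beta> \<in> I \<Longrightarrow> ?loc \<beta>" for \<alpha> I
  proof -
    obtain \<tau> e \<psi> where ap: "applicable T I \<tau> e" "\<psi> \<in> set (head \<tau>)"
      and \<alpha>: "\<alpha> = subst (\<lambda>v. if v \<in> vars (body \<tau>) then e else Null \<tau> e) \<psi>"
      using \<alpha> by (auto simp: apply_existential_def)
    then have \<tau>: "\<tau> \<in> T" "\<not> full \<tau>" "subst (\<lambda>_. e) (body \<tau>) \<in> I" by (auto simp: applicable_def)
    then obtain x where "vars (body \<tau>) = {x}" using nonfull_tgd_vars T by metis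
    then have "e \<in> vars (subst (\<lambda>_. e) (body \<tau>))" by auto
    then have "\<forall>a. e = Ind a \<longrightarrow> a = c" using I[OF \<tau>(3)] by blast
    moreover have "vars \<alpha> \<subseteq> {e, Null \<tau> e}" unfolding \<alpha> by auto
    ultimately show ?thesis by blast
  qed
  have "\<alpha> \<in> chase T {Atom P [c]} n \<Longrightarrow> ?loc \<alpha>" for n \<alpha>
  proof (induction n arbitrary: \<alpha>)
    case 0
    then show ?case using cl[of \<alpha> "subst Ind ` {Atom P [c]}"] by auto
  next
    case (Suc n)
    show ?case
    proof (rule cl)
      show "\<alpha> \<in> full_closure T (chase T {Atom P [c]} n \<union> apply_existential T (chase T {Atom P [c]} n))"
        using Suc.prems by simp
      show "?loc \<beta>" if "\<beta> \<in> chase T {Atom P [c]} n \<union> apply_existential T (chase T {Atom P [c]} n)" for \<beta>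
        using that Suc.IH ex[of \<beta> "chase T {Atom P [c]} n"] by blast
    qed
  qed
  then show ?thesis using assms(2) unfolding canonical_model_def by blast
qed

lemma fresh_tgd_root:
  "Atom S (replicate k (Ind 0)) \<in>
    canonical_model (insert (Tgd (Atom P [0]) [Atom S (replicate k 0)]) T) {Atom P [0]}"
proof -
  let ?\<rho> = "Tgd (Atom P [0]) [Atom S (replicate k 0)]"
  let ?C = "chase (insert ?\<rho> T) {Atom P [0]} 0"
  have f: "full ?\<rho>" by (auto simp: full_def head_vars_def)
  have "subst (\<lambda>_. Ind 0) (body ?\<rho>) \<in> ?C" by (auto intro!: full_closure.base)
  from chase_full_step[OF _ f this] have "subst (\<lambda>_. Ind 0) (Atom S (replicate k 0)) \<in> ?C" by simp
  then show ?thesis unfolding canonical_model_def by (intro UN_I[of 0]) simp_all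
qed

section \<open>Gluing rooted canonical models\<close>

lemma atom_of_two_vars:
  assumes "arity \<alpha> \<in> {1, 2}" "u \<in> vars \<alpha>" "v \<in> vars \<alpha>" "u \<noteq> v"
  shows "\<alpha> = Atom (pname \<alpha>) [u, v] \<or> \<alpha> = Atom (pname \<alpha>) [v, u]"
  using assms by (cases \<alpha>) (auto simp: length_Suc_conv numeral_2_eq_2)

lemma finite_ontology_predicates: "finite T \<Longrightarrow> finite (ontology_predicates T)"
  by (simp add: ontology_predicates_def)

lemma ontology_predicatesI:
  "\<tau> \<in> T \<Longrightarrow> \<alpha> \<in> insert (body \<tau>) (set (head \<tau>)) \<Longrightarrow> predicate \<alpha> \<in> ontology_predicates T"
  unfolding ontology_predicates_def by (intro UN_I imageI)

locale omq =
  fixes q :: cq and T :: "tgd set"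
  assumes cq: "is_cq q" and ontology: "is_ontology T"
begin

text \<open>Avoiding the predicates of the query as well keeps the seed atom of a root model from
  matching an atom of the query.\<close>

definition fresh :: nat where
  "fresh = (SOME P. (P, 1) \<notin> ontology_predicates T \<union> predicate ` set (cq_atoms q))"

lemma fresh: "(fresh, 1) \<notin> ontology_predicates T" "(fresh, 1) \<notin> predicate ` set (cq_atoms q)"
proof -
  have "finite (fst ` (ontology_predicates T \<union> predicate ` set (cq_atoms q)))"
    using ontology by (simp add: finite_ontology_predicates is_ontology_def)
  then obtain P where "P \<notin> fst ` (ontology_predicates T \<union> predicate ` set (cq_atoms q))"
    using ex_new_if_finite infinite_UNIV_nat by blast
  then have "\<exists>P. (P, 1) \<notin> ontology_predicates T \<union> predicate ` set (cq_atoms q)" by force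
  from someI_ex[OF this] show "(fresh, 1) \<notin> ontology_predicates T"
    "(fresh, 1) \<notin> predicate ` set (cq_atoms q)"
    unfolding fresh_def by blast+
qed

lemma is_tgd: "\<tau> \<in> T \<Longrightarrow> is_tgd \<tau>"
  using ontology by (simp add: is_ontology_def)

lemma arity_ontology_predicates: "(S, k) \<in> ontology_predicates T \<Longrightarrow> k \<in> {1, 2}"
  using is_tgd unfolding ontology_predicates_def is_tgd_def by blast

lemma arity_cq_atoms: "\<alpha> \<in> set (cq_atoms q) \<Longrightarrow> arity \<alpha> \<in> {1, 2}"
  using cq by (auto simp: is_cq_def)

text \<open>\<open>k\<close> is the arity of \<open>S\<close>, so that \<open>replicate k 0\<close>
  treats the roots \<open>S(x)\<close> and \<open>S(x,x)\<close> alike.\<close>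

definition root_model :: "nat \<Rightarrow> nat \<Rightarrow> (nat, elem) atom set" where
  "root_model S k =
     canonical_model (insert (Tgd (Atom fresh [0]) [Atom S (replicate k 0)]) T) {Atom fresh [0]}"

lemma is_tgd_root:
  assumes "(S, k) \<in> ontology_predicates T"
  shows "\<forall>\<tau>\<in>insert (Tgd (Atom fresh [0]) [Atom S (replicate k 0)]) T. is_tgd \<tau>"
proof -
  have "k \<in> {1, 2}" using arity_ontology_predicates[OF assms] .
  moreover from this have "{0} \<union> set (replicate k (0::nat)) = {0}" by auto
  ultimately show ?thesis using is_tgd by (auto simp: is_tgd_def[of "Tgd _ _"] head_vars_def)
qed

lemma root_model_root: "Atom S (replicate k (Ind 0)) \<in> root_model S k"
  unfolding root_model_def by (rule fresh_tgd_root)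

lemma root_model_closed:
  assumes "(S, k) \<in> ontology_predicates T" "\<tau> \<in> T" "subst h (body \<tau>) \<in> root_model S k"
  shows "\<exists>h'. (\<forall>x\<in>vars (body \<tau>). h' x = h x) \<and> (\<forall>\<psi>\<in>set (head \<tau>). subst h' \<psi> \<in> root_model S k)"
  using canonical_model_closed[OF is_tgd_root[OF assms(1)]] assms(2,3)
  unfolding root_model_def by blast

lemma root_model_local:
  assumes "(S, k) \<in> ontology_predicates T" "\<alpha> \<in> root_model S k"
  shows "\<exists>e \<tau>. vars \<alpha> \<subseteq> {e, Null \<tau> e}" "Ind a \<in> vars \<alpha> \<Longrightarrow> a = 0"
  using canonical_model_local[OF is_tgd_root[OF assms(1)]] assms(2)
  unfolding root_model_def by blast+

text \<open>Universality above any element \<open>d\<close> that satisfies the root atom: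
  \<open>fresh\<close> is foreign to \<open>T\<close>, so it can be reinterpreted to hold of
  \<open>d\<close> alone, which makes the root tgd true and leaves \<open>T\<close> untouched. The
  homomorphism then preserves the atoms over all other predicates.\<close>

lemma root_model_hom:
  fixes N :: "(nat, 'd) interp"
  assumes Sk: "(S, k) \<in> ontology_predicates T"
    and N: "is_interp N" "\<forall>\<tau>\<in>T. sat_tgd N \<tau>" and d: "d \<in> Dom N" "replicate k d \<in> Rel N S"
  obtains f where "f (Ind 0) = d" "range f \<subseteq> Dom N"
    "\<And>\<alpha>. \<alpha> \<in> root_model S k \<Longrightarrow> predicate \<alpha> \<noteq> (fresh, 1) \<Longrightarrow> holds N f \<alpha>"
proof -
  \<comment> \<open>\<open>Rel\<close> is indexed by names alone, so tuples of other lengths under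
    the name \<open>fresh\<close> are kept: they belong to other predicates, possibly of
    \<open>T\<close>.\<close>
  define N' :: "(nat, 'd) interp" where "N' = \<lparr>Dom = Dom N, Con = (\<lambda>_. d),
    Rel = (\<lambda>P. if P = fresh then {ds \<in> Rel N P. length ds \<noteq> 1} \<union> {[d]} else Rel N P)\<rparr>"
  have [simp]: "Dom N' = Dom N" "Con N' c = d" for c by (simp_all add: N'_def)
  have interp: "is_interp N'"
    using N(1) d(1) by (auto simp: is_interp_def N'_def)
  have same: "holds N' h \<alpha> \<longleftrightarrow> holds N h \<alpha>" if "predicate \<alpha> \<noteq> (fresh, 1)" for h and \<alpha> :: "(nat, 't) atom"
  proof (cases "pname \<alpha> = fresh")
    case True
    then have "length (map h (args \<alpha>)) \<noteq> 1" using that by simp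
    then have "map h (args \<alpha>) \<noteq> [d]" by (metis One_nat_def length_Cons list.size(3))
    then show ?thesis
      using True \<open>length (map h (args \<alpha>)) \<noteq> 1\<close> unfolding holds_def N'_def by simp
  qed (simp add: holds_def N'_def)
  have sat: "sat_tgd N' \<tau>" if "\<tau> \<in> T" for \<tau>
  proof -
    have "predicate \<alpha> \<noteq> (fresh, 1)" if "\<alpha> \<in> insert (body \<tau>) (set (head \<tau>))" for \<alpha>
      using fresh(1) ontology_predicatesI[OF \<open>\<tau> \<in> T\<close> that] by metis
    then have "holds N' h \<alpha> \<longleftrightarrow> holds N h \<alpha>" if "\<alpha> \<in> insert (body \<tau>) (set (head \<tau>))" for h \<alpha>
      using same that by blast
    then show ?thesis using N(2) \<open>\<tau> \<in> T\<close> by (simp add: sat_tgd_def)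
  qed
  have "replicate k d \<in> Rel N' S"
  proof -
    have "(S, k) \<noteq> (fresh, 1)" using Sk fresh(1) by blast
    then show ?thesis using d(2) by (auto simp: N'_def)
  qed
  then have "sat_tgd N' (Tgd (Atom fresh [0]) [Atom S (replicate k 0)])"
    by (auto simp: sat_tgd_def holds_def N'_def intro!: exI)
  then have T': "\<forall>\<tau>\<in>insert (Tgd (Atom fresh [0]) [Atom S (replicate k 0)]) T. sat_tgd N' \<tau>"
    using sat by blast
  have "sat_data N' {Atom fresh [0]}" by (simp add: sat_data_def holds_def N'_def)
  from canonical_model_hom[OF is_tgd_root[OF Sk] interp T' this]
  obtain f where f: "\<And>c. f (Ind c) = Con N' c" "range f \<subseteq> Dom N'"
    "\<And>\<alpha>. \<alpha> \<in> root_model S k \<Longrightarrow> holds N' f \<alpha>"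
    unfolding root_model_def by blast
  show thesis
  proof (rule that[of f])
    show "holds N f \<alpha>" if "\<alpha> \<in> root_model S k" "predicate \<alpha> \<noteq> (fresh, 1)" for \<alpha>
      using f(3)[OF that(1)] same[OF that(2)] by blast
  qed (use f in simp_all)
qed

text \<open>By universality of the root model. A match found in one rooted model thus becomes a
  condition on \<open>q\<close> and \<open>T\<close> alone, so that the program can be fixed before
  the data are known.\<close>

lemma root_model_entails_cq:
  assumes Sk: "(S, k) \<in> ontology_predicates T"
    and h: "\<And>x. x \<in> set xs \<Longrightarrow> h x = Ind 0"
      "\<And>\<alpha>. \<alpha> \<in> set \<phi> \<Longrightarrow> subst h \<alpha> \<in> root_model S k \<and> predicate \<alpha> \<noteq> (fresh, 1)"
  shows "entails_cq T {Atom S (replicate k 0)} (Cq xs \<phi>) (map (\<lambda>_. 0) xs)"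
  unfolding entails_cq_def
proof (intro allI impI, elim conjE)
  fix M :: "(nat, nat) interp"
  assume M: "is_interp M" "\<forall>\<tau>\<in>T. sat_tgd M \<tau>" "sat_data M {Atom S (replicate k 0)}"
  have "Con M 0 \<in> Dom M" "replicate k (Con M 0) \<in> Rel M S"
    using M by (auto simp: is_interp_def sat_data_def holds_def)
  then obtain f where f: "f (Ind 0) = Con M 0" "range f \<subseteq> Dom M"
    "\<And>\<alpha>. \<alpha> \<in> root_model S k \<Longrightarrow> predicate \<alpha> \<noteq> (fresh, 1) \<Longrightarrow> holds M f \<alpha>"
    using root_model_hom[OF Sk M(1,2)] by metis
  have "holds M (\<lambda>x. f (h x)) \<alpha>" if "\<alpha> \<in> set \<phi>" for \<alpha>
    using f(3)[of "subst h \<alpha>"] h(2)[OF that] by simp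
  then show "sat_cq M (Cq xs \<phi>) (map (Con M) (map (\<lambda>_. 0) xs))"
    using f(1,2) h(1) unfolding sat_cq_def by (intro exI[of _ "\<lambda>x. f (h x)"]) auto
qed

text \<open>Interpreting every constant as \<open>d\<close> makes \<open>N\<close> a model of the
  one-atom data, so an entailment tested at the constant 0 applies at every element where the root
  atom holds.\<close>

lemma entails_cq_at:
  fixes N :: "(nat, 'd) interp"
  assumes "entails_cq T {Atom S (replicate k 0)} (Cq xs \<phi>) (map (\<lambda>_. 0) xs)"
    and N: "is_interp N" "\<forall>\<tau>\<in>T. sat_tgd N \<tau>" "d \<in> Dom N" "replicate k d \<in> Rel N S"
  obtains h where "range h \<subseteq> Dom N" "\<And>x. x \<in> set xs \<Longrightarrow> h x = d" "\<And>\<alpha>. \<alpha> \<in> set \<phi> \<Longrightarrow> holds N h \<alpha>"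
proof -
  let ?N = "N\<lparr>Con := \<lambda>_. d\<rparr>"
  have hN: "holds ?N h \<alpha> = holds N h \<alpha>" for h and \<alpha> :: "(nat, 't) atom" by (simp add: holds_def)
  have "is_interp ?N" using N(1,3) by (auto simp: is_interp_def)
  moreover have "\<forall>\<tau>\<in>T. sat_tgd ?N \<tau>" using N(2) by (simp add: sat_tgd_def hN)
  moreover have "sat_data ?N {Atom S (replicate k 0)}" using N(4) by (simp add: sat_data_def holds_def)
  ultimately have "sat_cq ?N (Cq xs \<phi>) (map (Con ?N) (map (\<lambda>_. 0) xs))"
    by (rule entails_cqD[OF assms(1)])
  then obtain h where "range h \<subseteq> Dom N" "map h xs = map (\<lambda>_. d) xs" "\<forall>\<alpha>\<in>set \<phi>. holds N h \<alpha>"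
    by (auto simp: sat_cq_def hN comp_def)
  then show thesis using that[of h] by simp
qed

text \<open>Nulls carry the name of their copy, which keeps the copies disjoint; the only individual
  occurring in a root model is the root, and it becomes \<open>a\<close>. For the same reason
  \<open>unplace\<close> can send all individuals to \<open>Ind 0\<close>.\<close>

definition place :: "nat \<Rightarrow> nat \<Rightarrow> nat \<Rightarrow> elem \<Rightarrow> nat + nat \<times> nat \<times> nat \<times> elem" where
  "place S k a e = (case e of Ind _ \<Rightarrow> Inl a | Null _ _ \<Rightarrow> Inr (S, k, a, e))"

definition unplace :: "nat + nat \<times> nat \<times> nat \<times> elem \<Rightarrow> elem" where
  "unplace d = (case d of Inl _ \<Rightarrow> Ind 0 | Inr (_, _, _, e) \<Rightarrow> e)"

text \<open>Bodies of tgds are single atoms, so every trigger lies in one part of this union. The roots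
  \<open>S(a)\<close> and \<open>S(a,a)\<close> suffice because a tgd with two body variables is full, and full tgds cannot add
  anything to complete data.\<close>

definition glued :: "data \<Rightarrow> (nat, nat + nat \<times> nat \<times> nat \<times> elem) atom set" where
  "glued A = subst Inl ` A \<union> {subst (place S k a) \<beta> | S k a \<beta>.
     (S, k) \<in> ontology_predicates T \<and> Atom S (replicate k a) \<in> A \<and> \<beta> \<in> root_model S k}"

definition glued_model :: "data \<Rightarrow> (nat, nat + nat \<times> nat \<times> nat \<times> elem) interp" where
  "glued_model A = \<lparr>Dom = UNIV, Con = Inl, Rel = (\<lambda>P. {ds. Atom P ds \<in> glued A})\<rparr>"

lemma holds_glued_model [simp]: "holds (glued_model A) h \<alpha> \<longleftrightarrow> subst h \<alpha> \<in> glued A"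
  by (cases \<alpha>) (simp add: holds_def glued_model_def)

lemma glued_model_simps [simp]: "Dom (glued_model A) = UNIV" "Con (glued_model A) = Inl"
  by (simp_all add: glued_model_def)

lemma unplace_place:
  assumes "(S, k) \<in> ontology_predicates T" "\<beta> \<in> root_model S k" "e \<in> vars \<beta>"
  shows "unplace (place S k a e) = e"
  using root_model_local(2)[OF assms(1,2)] assms(3)
  by (cases e) (auto simp: unplace_def place_def)

lemma glued_model_sat_tgd:
  assumes complete: "complete_for T A" and \<tau>: "\<tau> \<in> T"
  shows "sat_tgd (glued_model A) \<tau>"
  unfolding sat_tgd_def
proof (intro allI impI, elim conjE)
  fix h :: "nat \<Rightarrow> nat + nat \<times> nat \<times> nat \<times> elem"
  assume "holds (glued_model A) h (body \<tau>)"
  then have "subst h (body \<tau>) \<in> glued A" by simp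
  then consider \<beta> where "\<beta> \<in> A" "subst h (body \<tau>) = subst Inl \<beta>"
    | S k a \<beta> where "(S, k) \<in> ontology_predicates T" "Atom S (replicate k a) \<in> A"
      "\<beta> \<in> root_model S k" "subst h (body \<tau>) = subst (place S k a) \<beta>"
    unfolding glued_def by blast
  \<comment> \<open>A trigger inside a copy is pulled back along \<open>unplace\<close>, answered in
    the root model and pushed forward again.\<close>
  moreover have root: "\<exists>h'. (\<forall>x\<in>vars (body \<tau>). h' x = h x) \<and> (\<forall>\<psi>\<in>set (head \<tau>). subst h' \<psi> \<in> glued A)"
    if Sk: "(S, k) \<in> ontology_predicates T" and a: "Atom S (replicate k a) \<in> A"
      and \<beta>: "\<beta> \<in> root_model S k" "subst h (body \<tau>) = subst (place S k a) \<beta>" for S k a \<beta>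
  proof -
    have args: "map h (args (body \<tau>)) = map (place S k a) (args \<beta>)"
      using arg_cong[OF \<beta>(2), of args] by simp
    have "map (\<lambda>x. unplace (h x)) (args (body \<tau>)) = map unplace (map h (args (body \<tau>)))" by simp
    also have "\<dots> = map (\<lambda>e. unplace (place S k a e)) (args \<beta>)" unfolding args by simp
    also have "\<dots> = args \<beta>" using unplace_place[OF Sk \<beta>(1)] by (simp add: map_idI)
    finally have "subst (\<lambda>x. unplace (h x)) (body \<tau>) = \<beta>"
      using arg_cong[OF \<beta>(2), of pname] by (cases \<beta>, cases "body \<tau>") simp
    with root_model_closed[OF Sk \<tau>, of "\<lambda>x. unplace (h x)"] \<beta>(1)
    obtain h' where h': "\<forall>x\<in>vars (body \<tau>). h' x = unplace (h x)"
      "\<forall>\<psi>\<in>set (head \<tau>). subst h' \<psi> \<in> root_model S k" by auto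
    have "place S k a (h' x) = h x" if "x \<in> vars (body \<tau>)" for x
    proof -
      have "h x \<in> set (map (place S k a) (args \<beta>))" using that unfolding args[symmetric] by simp
      then show ?thesis using h'(1) that unplace_place[OF Sk \<beta>(1)] by auto
    qed
    moreover have "subst (\<lambda>x. place S k a (h' x)) \<psi> \<in> glued A" if "\<psi> \<in> set (head \<tau>)" for \<psi>
    proof -
      have "subst (place S k a) (subst h' \<psi>) \<in> glued A"
        using h'(2) that Sk a unfolding glued_def by blast
      then show ?thesis by simp
    qed
    ultimately show ?thesis by (intro exI[of _ "\<lambda>x. place S k a (h' x)"]) blast
  qed
  moreover have "\<exists>h'. (\<forall>x\<in>vars (body \<tau>). h' x = h x) \<and> (\<forall>\<psi>\<in>set (head \<tau>). subst h' \<psi> \<in> glued A)"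
    if \<beta>: "\<beta> \<in> A" "subst h (body \<tau>) = subst Inl \<beta>" for \<beta>
  proof -
    have args: "map h (args (body \<tau>)) = map Inl (args \<beta>)"
      using arg_cong[OF \<beta>(2), of args] by simp
    define g where "g x = projl (h x)" for x
    have hg: "h x = Inl (g x)" if "x \<in> vars (body \<tau>)" for x
    proof -
      have "h x \<in> set (map Inl (args \<beta>))" using that unfolding args[symmetric] by simp
      then show ?thesis by (auto simp: g_def)
    qed
    have g: "subst g (body \<tau>) = \<beta>"
    proof -
      have "map g (args (body \<tau>)) = map projl (map h (args (body \<tau>)))" by (simp add: g_def)
      then have "map g (args (body \<tau>)) = args \<beta>" unfolding args by (simp add: comp_def)
      then show ?thesis using arg_cong[OF \<beta>(2), of pname] by (cases \<beta>, cases "body \<tau>") simp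
    qed
    show ?thesis
    proof (cases "full \<tau>")
      case True
      \<comment> \<open>The head speaks of individuals only and is entailed, so complete data
        already contain it.\<close>
      have "subst h \<psi> \<in> glued A" if \<psi>: "\<psi> \<in> set (head \<tau>)" for \<psi>
      proof -
        have sub: "vars \<psi> \<subseteq> vars (body \<tau>)" using True \<psi> by (auto simp: full_def head_vars_def)
        have "entails_atom T A (subst g \<psi>)"
          unfolding entails_atom_def
        proof (intro allI impI, elim conjE)
          fix M :: "(nat, nat) interp"
          assume M: "is_interp M" "\<forall>\<tau>\<in>T. sat_tgd M \<tau>" "sat_data M A"
          have "holds M (\<lambda>x. Con M (g x)) (body \<tau>)"
            using M(3) \<beta>(1) g unfolding sat_data_def by (metis holds_subst)
          moreover have "range (\<lambda>x. Con M (g x)) \<subseteq> Dom M" using M(1) by (auto simp: is_interp_def)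
          ultimately obtain h' where h': "\<forall>x\<in>vars (body \<tau>). h' x = Con M (g x)" "holds M h' \<psi>"
            using bspec[OF M(2) \<tau>] \<psi> unfolding sat_tgd_def by blast
          have "holds M h' \<psi> \<longleftrightarrow> holds M (\<lambda>x. Con M (g x)) \<psi>"
            using h'(1) sub by (intro holds_cong) blast
          then show "holds M (Con M) (subst g \<psi>)" using h'(2) by simp
        qed
        moreover have "set (args (subst g \<psi>)) \<subseteq> ind A"
        proof -
          have "set (args (subst g \<psi>)) \<subseteq> set (args \<beta>)" using sub unfolding g[symmetric] by auto
          then show ?thesis using \<beta>(1) by (auto simp: ind_def)
        qed
        ultimately have "subst g \<psi> \<in> A" using complete unfolding complete_for_def by blast
        then have "subst Inl (subst g \<psi>) \<in> glued A" unfolding glued_def by blast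
        moreover have "subst Inl (subst g \<psi>) = subst h \<psi>"
          unfolding subst_subst using hg sub by (intro subst_cong) auto
        ultimately show ?thesis by simp
      qed
      then show ?thesis by blast
    next
      case False
      then obtain x where x: "vars (body \<tau>) = {x}" using nonfull_tgd_vars is_tgd \<tau> by metis
      \<comment> \<open>With a single variable the body becomes \<open>S(a)\<close> or
        \<open>S(a,a)\<close>, the root atom of a copy, so the trigger is answered in that
        copy.\<close>
      define S k where "S = pname (body \<tau>)" and "k = arity (body \<tau>)"
      have rep: "args (body \<tau>) = replicate k x"
        using x by (metis k_def replicate_eqI singletonD)
      then have b: "body \<tau> = Atom S (replicate k x)" unfolding S_def by (metis atom.collapse)
      have Sk: "(S, k) \<in> ontology_predicates T"
        using \<tau> unfolding ontology_predicates_def S_def k_def by blast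
      show ?thesis
      proof (rule root[OF Sk _ root_model_root])
        show "Atom S (replicate k (g x)) \<in> A" using \<beta>(1) g b by auto
        show "subst h (body \<tau>) = subst (place S k (g x)) (Atom S (replicate k (Ind 0)))"
          using hg[of x] x unfolding b by (simp add: place_def)
      qed
    qed
  qed
  ultimately show "\<exists>h'. range h' \<subseteq> Dom (glued_model A) \<and> (\<forall>x\<in>vars (body \<tau>). h' x = h x) \<and>
    (\<forall>\<psi>\<in>set (head \<tau>). holds (glued_model A) h' \<psi>)"
    unfolding holds_glued_model glued_model_simps by (metis top_greatest)
qed

lemma glued_model_sat_data: "sat_data (glued_model A) A"
  by (auto simp: sat_data_def glued_def)

lemma is_interp_glued_model: "is_interp (glued_model A)"
  by (auto simp: is_interp_def)

text \<open>By universality the atom is entailed at \<open>a\<close>, and completeness puts it into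
  the data. Atoms between individuals thus never have to be sought in a copy.\<close>

lemma root_model_atom_at_root:
  assumes complete: "complete_for T A" and Sk: "(S, k) \<in> ontology_predicates T"
    and a: "Atom S (replicate k a) \<in> A"
    and \<beta>: "\<beta> \<in> root_model S k" "predicate \<beta> \<noteq> (fresh, 1)" "vars \<beta> \<subseteq> {Ind 0}"
  shows "subst (\<lambda>_. a) \<beta> \<in> A"
proof -
  have "k > 0" using arity_ontology_predicates[OF Sk] by auto
  then have ia: "a \<in> ind A" using a by (force simp: ind_def)
  have "entails_atom T A (subst (\<lambda>_. a) \<beta>)"
    unfolding entails_atom_def
  proof (intro allI impI, elim conjE)
    fix M :: "(nat, nat) interp"
    assume M: "is_interp M" "\<forall>\<tau>\<in>T. sat_tgd M \<tau>" "sat_data M A"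
    have "Con M a \<in> Dom M" using M(1) by (auto simp: is_interp_def)
    moreover have "replicate k (Con M a) \<in> Rel M S"
      using bspec[OF M(3)[unfolded sat_data_def] a] by (simp add: holds_def)
    ultimately obtain f where "f (Ind 0) = Con M a" "holds M f \<beta>"
      using root_model_hom[OF Sk M(1,2)] \<beta>(1,2) by metis
    moreover have "holds M f \<beta> \<longleftrightarrow> holds M (\<lambda>_. f (Ind 0)) \<beta>"
      using \<beta>(3) by (intro holds_cong) auto
    ultimately show "holds M (Con M) (subst (\<lambda>_. a) \<beta>)" by simp
  qed
  moreover have "vars (subst (\<lambda>_. a) \<beta>) \<subseteq> ind A" using ia by auto
  ultimately show ?thesis using complete unfolding complete_for_def by blast
qed

end

section \<open>Matches of the query\<close>

context omq
begin

definition vs :: "nat list" where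
  "vs = remdups (concat (map args (cq_atoms q)))"

lemma set_vs: "set vs = (\<Union>\<alpha>\<in>set (cq_atoms q). vars \<alpha>)"
  by (simp add: vs_def)

definition ev :: "nat set" where
  "ev = set vs - set (answer_vars q)"

text \<open>Irreflexive, so that a loop atom on \<open>y\<close> constrains the tree witness of
  \<open>y\<close> without making \<open>y\<close> its own neighbour.\<close>

definition adj :: "(nat \<times> nat) set" where
  "adj = {(y, z). y \<noteq> z \<and> (\<exists>\<alpha>\<in>set (cq_atoms q). y \<in> vars \<alpha> \<and> z \<in> vars \<alpha>)}"

definition component :: "nat \<Rightarrow> (nat, nat) atom list" where
  "component v = filter (\<lambda>\<alpha>. \<exists>u\<in>vars \<alpha>. (v, u) \<in> adj\<^sup>*) (cq_atoms q)"

text \<open>Entailment also admits matches that use the root. These are sound as well, and the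
  weaker test covers nulls at any distance from the root without describing them. Answer variables
  are excluded because their values are prescribed.\<close>

definition detached :: "nat \<Rightarrow> nat \<Rightarrow> nat \<Rightarrow> bool" where
  "detached v S k \<longleftrightarrow> (S, k) \<in> ontology_predicates T \<and> (\<forall>u\<in>set (answer_vars q). (v, u) \<notin> adj\<^sup>*) \<and>
     entails_cq T {Atom S (replicate k 0)} (Cq [] (component v)) []"

text \<open>The tree witness for \<open>y\<close>: its atoms, with \<open>y\<close> renamed to \<open>0\<close> and all its neighbours
  identified with the root \<open>1\<close>.\<close>

definition star :: "nat \<Rightarrow> cq" where
  "star y = Cq [1] (map (subst (\<lambda>v. if v = y then 0 else 1)) (filter (\<lambda>\<alpha>. y \<in> vars \<alpha>) (cq_atoms q)))"

definition witnessed :: "nat \<Rightarrow> nat \<Rightarrow> nat \<Rightarrow> bool" where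
  "witnessed y S k \<longleftrightarrow> (S, k) \<in> ontology_predicates T \<and> entails_cq T {Atom S (replicate k 0)} (star y) [0]"

definition det :: "data \<Rightarrow> nat \<Rightarrow> bool" where
  "det A v \<longleftrightarrow> (\<exists>S k a. detached v S k \<and> Atom S (replicate k a) \<in> A)"

text \<open>For a variable sent to a null, \<open>g y\<close> is not its image but the individual to
  which the null is attached. The neighbours of \<open>y\<close> are sent to that individual, so
  \<open>g\<close> must agree on them and \<open>y\<close>.\<close>

definition tw :: "data \<Rightarrow> (nat \<Rightarrow> nat) \<Rightarrow> nat \<Rightarrow> bool" where
  "tw A g y \<longleftrightarrow> (\<exists>S k. witnessed y S k \<and> Atom S (replicate k (g y)) \<in> A) \<and> (\<forall>z. (y, z) \<in> adj \<longrightarrow> g z = g y)"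

text \<open>Such an atom is satisfied whatever \<open>I\<close> is. Its first argument stands for
  its component, on which \<open>det\<close> is constant.\<close>

definition pa :: "data \<Rightarrow> (nat \<Rightarrow> nat) \<Rightarrow> (nat, nat) atom \<Rightarrow> bool" where
  "pa A g \<alpha> \<longleftrightarrow> subst g \<alpha> \<in> A \<or> det A (hd (args \<alpha>))"

text \<open>\<open>I\<close> is the set of variables that are mapped to nulls attached to individuals.\<close>

definition match :: "data \<Rightarrow> (nat \<Rightarrow> nat) \<Rightarrow> nat set \<Rightarrow> bool" where
  "match A g I \<longleftrightarrow> I \<subseteq> ev \<and> (\<forall>y\<in>I. tw A g y) \<and> (\<forall>y\<in>I. \<forall>z\<in>I. (y, z) \<notin> adj) \<and>
     (\<forall>\<alpha>\<in>set (cq_atoms q). pa A g \<alpha> \<or> vars \<alpha> \<inter> I \<noteq> {})"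

lemma sym_adj: "sym adj"
  by (auto simp: adj_def sym_def)

lemma hd_in_vars: "\<alpha> \<in> set (cq_atoms q) \<Longrightarrow> hd (args \<alpha>) \<in> vars \<alpha>"
  using arity_cq_atoms by (metis empty_iff insert_iff list.set_sel(1) list.size(3) numeral_2_eq_2 One_nat_def nat.distinct(1))

lemma atom_vars_connected:
  "\<alpha> \<in> set (cq_atoms q) \<Longrightarrow> u \<in> vars \<alpha> \<Longrightarrow> v \<in> vars \<alpha> \<Longrightarrow> (u, v) \<in> adj\<^sup>*"
  by (cases "u = v") (auto simp: adj_def)

lemma connected_iff:
  assumes "(u, v) \<in> adj\<^sup>*"
  shows "(u, w) \<in> adj\<^sup>* \<longleftrightarrow> (v, w) \<in> adj\<^sup>*"
proof -
  have "(v, u) \<in> adj\<^sup>*" using assms sym_rtrancl[OF sym_adj] by (meson symD)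
  then show ?thesis using assms by (meson rtrancl_trans)
qed

lemma connected_component:
  assumes "(u, v) \<in> adj\<^sup>*"
  shows "component u = component v" "det A u \<longleftrightarrow> det A v"
proof -
  show *: "component u = component v" unfolding component_def connected_iff[OF assms] ..
  show "det A u \<longleftrightarrow> det A v" unfolding det_def detached_def * connected_iff[OF assms] ..
qed

text \<open>Three sources of values are pasted: one match per detached component, one star match per
  variable in \<open>I\<close>, and \<open>g\<close> for the rest. They fit because components share
  no variable and no atom contains two distinct variables of \<open>I\<close>.\<close>

lemma match_sound:
  assumes "match A g I"
  shows "entails_cq T A q (map g (answer_vars q))"
  unfolding entails_cq_def
proof (intro allI impI, elim conjE)
  fix N :: "(nat, nat) interp"
  assume N: "is_interp N" "\<forall>\<tau>\<in>T. sat_tgd N \<tau>" "sat_data N A"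
  have con: "Con N a \<in> Dom N" for a using N(1) by (auto simp: is_interp_def)
  have data: "holds N (Con N) \<alpha>" if "\<alpha> \<in> A" for \<alpha> using N(3) that by (simp add: sat_data_def)
  have root: "replicate k (Con N a) \<in> Rel N S" if "Atom S (replicate k a) \<in> A" for S k a
    using data[OF that] by (simp add: holds_def)
  \<comment> \<open>Chosen from the list of atoms, not from a variable, so that all variables of a
    component get the same match.\<close>
  define D where "D \<phi> = (SOME h. range h \<subseteq> Dom N \<and> (\<forall>\<alpha>\<in>set \<phi>. holds N h \<alpha>))"
    for \<phi> :: "(nat, nat) atom list"
  have D: "range (D (component v)) \<subseteq> Dom N \<and> (\<forall>\<alpha>\<in>set (component v). holds N (D (component v)) \<alpha>)"
    if det: "det A v" for v
  proof -
    obtain S k a where "detached v S k" "Atom S (replicate k a) \<in> A" using det by (auto simp: det_def)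
    moreover from this(1) have "entails_cq T {Atom S (replicate k 0)} (Cq [] (component v)) (map (\<lambda>_. 0) [])"
      by (simp add: detached_def)
    ultimately have "\<exists>h. range h \<subseteq> Dom N \<and> (\<forall>\<alpha>\<in>set (component v). holds N h \<alpha>)"
      using entails_cq_at[OF _ N(1,2) con root] by metis
    then show ?thesis unfolding D_def by (rule someI_ex)
  qed
  have "\<exists>d. d \<in> Dom N \<and> (\<forall>\<alpha>\<in>set (cq_atoms q). y \<in> vars \<alpha> \<longrightarrow>
      holds N (\<lambda>v. if v = y then d else Con N (g y)) \<alpha>)" if y: "y \<in> I" for y
  proof -
    obtain S k where Sk: "witnessed y S k" "Atom S (replicate k (g y)) \<in> A"
      using assms y unfolding match_def tw_def by blast
    define \<phi> :: "(nat, nat) atom list" where "\<phi> = map (subst (\<lambda>v. if v = y then 0 else 1)) (filter (\<lambda>\<alpha>. y \<in> vars \<alpha>) (cq_atoms q))"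
    have "entails_cq T {Atom S (replicate k 0)} (Cq [1] \<phi>) (map (\<lambda>_. 0) [1::nat])"
      using Sk(1) by (simp add: witnessed_def star_def \<phi>_def)
    then obtain h where h: "range h \<subseteq> Dom N" "h 1 = Con N (g y)" "\<And>\<alpha>. \<alpha> \<in> set \<phi> \<Longrightarrow> holds N h \<alpha>"
      using entails_cq_at[OF _ N(1,2) con root[OF Sk(2)]] by (metis list.set_intros(1))
    have "holds N (\<lambda>v. if v = y then h 0 else Con N (g y)) \<alpha>" if "\<alpha> \<in> set (cq_atoms q)" "y \<in> vars \<alpha>" for \<alpha>
    proof -
      have "holds N h (subst (\<lambda>v. if v = y then 0 else 1) \<alpha>)" by (rule h(3)) (simp add: \<phi>_def that)
      moreover have "(\<lambda>v. h (if v = y then 0 else 1)) = (\<lambda>v. if v = y then h 0 else Con N (g y))"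
        using h(2) by auto
      ultimately show ?thesis by simp
    qed
    then show ?thesis using h(1) by blast
  qed
  then obtain W where W: "\<And>y. y \<in> I \<Longrightarrow> W y \<in> Dom N"
    "\<And>y \<alpha>. y \<in> I \<Longrightarrow> \<alpha> \<in> set (cq_atoms q) \<Longrightarrow> y \<in> vars \<alpha> \<Longrightarrow>
       holds N (\<lambda>v. if v = y then W y else Con N (g y)) \<alpha>"
    by metis
  \<comment> \<open>Detached components take precedence: a variable of \<open>I\<close> inside one
    follows the match of the component, along with its neighbours.\<close>
  define H where "H v = (if det A v then D (component v) v else if v \<in> I then W v else Con N (g v))" for v
  have dom: "range H \<subseteq> Dom N" using D W(1) con by (auto simp: H_def)
  have "H v = Con N (g v)" if "v \<in> set (answer_vars q)" for v
  proof -
    have "\<not> det A v" using that by (auto simp: det_def detached_def)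
    moreover have "v \<notin> I" using assms that by (auto simp: match_def ev_def)
    ultimately show ?thesis by (simp add: H_def)
  qed
  then have ans: "map H (answer_vars q) = map (Con N) (map g (answer_vars q))" by simp
  have "holds N H \<alpha>" if \<alpha>: "\<alpha> \<in> set (cq_atoms q)" for \<alpha>
  proof -
    define v where "v = hd (args \<alpha>)"
    have v: "v \<in> vars \<alpha>" using hd_in_vars[OF \<alpha>] by (simp add: v_def)
    have conn: "component u = component v" "det A u \<longleftrightarrow> det A v" if "u \<in> vars \<alpha>" for u
      using connected_component atom_vars_connected[OF \<alpha> that v] by blast+
    show ?thesis
    proof (cases "det A v")
      case True
      have "\<alpha> \<in> set (component v)" using \<alpha> v by (auto simp: component_def)
      then have "holds N (D (component v)) \<alpha>" using D[OF True] by blast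
      moreover have "holds N H \<alpha> \<longleftrightarrow> holds N (D (component v)) \<alpha>"
        by (intro holds_cong) (simp add: H_def conn True)
      ultimately show ?thesis by blast
    next
      case False
      show ?thesis
      proof (cases "vars \<alpha> \<inter> I = {}")
        case True
        then have "subst g \<alpha> \<in> A" using assms \<alpha> False by (auto simp: match_def pa_def v_def)
        from data[OF this] have "holds N (\<lambda>v. Con N (g v)) \<alpha>" by simp
        moreover have "holds N H \<alpha> \<longleftrightarrow> holds N (\<lambda>v. Con N (g v)) \<alpha>"
        proof (intro holds_cong)
          fix u assume "u \<in> vars \<alpha>"
          then show "H u = Con N (g u)" using True conn False by (auto simp: H_def)
        qed
        ultimately show ?thesis by blast
      next
        case ne: False
        then obtain y where y: "y \<in> vars \<alpha>" "y \<in> I" by blast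
        have "holds N H \<alpha> \<longleftrightarrow> holds N (\<lambda>v. if v = y then W y else Con N (g y)) \<alpha>"
        proof (intro holds_cong)
          fix u assume u: "u \<in> vars \<alpha>"
          show "H u = (if u = y then W y else Con N (g y))"
          proof (cases "u = y")
            case True
            then show ?thesis using y conn False by (simp add: H_def)
          next
            case False
            then have "(y, u) \<in> adj" using \<alpha> u y(1) by (auto simp: adj_def)
            then have "u \<notin> I" "g u = g y" using assms y(2) unfolding match_def tw_def by blast+
            then show ?thesis using False u conn \<open>\<not> det A v\<close> by (simp add: H_def)
          qed
        qed
        then show ?thesis using W(2)[OF y(2) \<alpha> y(1)] by blast
      qed
    qed
  qed
  then show "sat_cq N q (map (Con N) (map g (answer_vars q)))"
    using dom ans unfolding sat_cq_def by blast
qed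

end

section \<open>Entailed queries have matches in depth 1\<close>

locale depth_one_omq = omq +
  assumes depth: "of_depth T 1"
begin

lemma root_model_no_chain:
  assumes Sk: "(S, k) \<in> ontology_predicates T"
    and "chain_step (root_model S k) u v" "chain_step (root_model S k) v w"
  shows False
proof -
  have "Tgd (Atom fresh [0]) [Atom S (replicate k 0)] \<in> root_tgds T fresh"
    using Sk arity_ontology_predicates[OF Sk] by (auto simp: root_tgds_def numeral_2_eq_2)
  then have "root_model S k \<in> rooted_models T"
    using fresh(1) unfolding rooted_models_def root_model_def by blast
  then have "\<not> has_chain (root_model S k) 2" using depth by (simp add: of_depth_def)
  moreover have "has_chain (root_model S k) 2"
    unfolding has_chain_def
    by (rule exI[of _ "\<lambda>i. if i = 0 then u else if i = 1 then v else w"])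
      (use assms(2,3) in \<open>auto simp: less_2_cases_iff\<close>)
  ultimately show False by blast
qed

text \<open>Sharing an atom with the root, \<open>n\<close> is a null created at the root, which
  gives a chain step from the root to \<open>n\<close>. By the tree shape any other neighbour would
  be \<open>n\<close> itself or a null created at \<open>n\<close>, and either gives a second
  step.\<close>

lemma leaf_neighbour:
  assumes Sk: "(S, k) \<in> ontology_predicates T"
    and \<alpha>: "\<alpha> \<in> root_model S k" "arity \<alpha> \<in> {1, 2}" "n \<in> vars \<alpha>" "Ind 0 \<in> vars \<alpha>" "n \<noteq> Ind 0"
    and \<beta>: "Atom R [n, e] \<in> root_model S k \<or> Atom R [e, n] \<in> root_model S k"
  shows "e = Ind 0"
proof -
  obtain e' \<tau> where "vars \<alpha> \<subseteq> {e', Null \<tau> e'}" using root_model_local(1)[OF Sk \<alpha>(1)] by blast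
  then have n: "n = Null \<tau> (Ind 0)" using \<alpha>(3-5) by auto
  have "chain_step (root_model S k) (Ind 0) n"
    using atom_of_two_vars[OF \<alpha>(2,3,4,5)] \<alpha>(1) n unfolding chain_step_def by metis
  then have no: "\<not> chain_step (root_model S k) n e" using root_model_no_chain[OF Sk] by blast
  obtain \<beta> where "\<beta> \<in> root_model S k" "vars \<beta> = {n, e}" using \<beta> by force
  then obtain e' \<tau>' where e': "{n, e} \<subseteq> {e', Null \<tau>' e'}" using root_model_local(1)[OF Sk] by metis
  have "e \<noteq> n \<and> e \<noteq> Null \<tau>' n" using no \<beta> n unfolding chain_step_def by blast
  then have "n = Null \<tau>' e" using e' by auto
  then show ?thesis using n by simp
qed

text \<open>The query is evaluated in the glued model, and \<open>g\<close> sends each variable to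
  the individual whose copy contains its image. The last conclusion confines the values of
  \<open>g\<close> to atoms over predicates of \<open>q\<close> and \<open>T\<close>, the ones that
  a program fixed in advance can name.\<close>

lemma match_complete:
  assumes complete: "complete_for T A" and ent: "entails_cq T A q as"
  obtains g I where "map g (answer_vars q) = as" "match A g I"
    "\<And>v. v \<in> set vs \<Longrightarrow> \<exists>S bs. (S, length bs) \<in> ontology_predicates T \<union> predicate ` set (cq_atoms q) \<and>
       Atom S bs \<in> A \<and> g v \<in> set bs"
proof -
  have "sat_cq (glued_model A) q (map (Con (glued_model A)) as)"
    by (rule entails_cqD[OF ent is_interp_glued_model _ glued_model_sat_data])
      (simp add: glued_model_sat_tgd[OF complete])
  then obtain h where ans: "map h (answer_vars q) = map Inl as"
    and h: "\<And>\<alpha>. \<alpha> \<in> set (cq_atoms q) \<Longrightarrow> subst h \<alpha> \<in> glued A"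
    unfolding sat_cq_def holds_glued_model glued_model_simps by blast
  define g where "g v = (case h v of Inl a \<Rightarrow> a | Inr (_, _, a, _) \<Rightarrow> a)" for v
  define e where "e v = unplace (h v)" for v
  have not_fresh: "predicate \<alpha> \<noteq> (fresh, 1)" if "\<alpha> \<in> set (cq_atoms q)" for \<alpha>
  proof
    assume "predicate \<alpha> = (fresh, 1)"
    then have "(fresh, 1) \<in> predicate ` set (cq_atoms q)" by (rule image_eqI[OF sym that])
    with fresh(2) show False by contradiction
  qed
  \<comment> \<open>An elimination rule: an atom of the query is matched in the data or inside one
    copy, and in the latter case \<open>e\<close> is its match in the root model.\<close>
  have cases: thesis'
    if \<alpha>: "\<alpha> \<in> set (cq_atoms q)"
      and data: "subst g \<alpha> \<in> A \<Longrightarrow> \<forall>v\<in>vars \<alpha>. h v = Inl (g v) \<Longrightarrow> thesis'"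
      and root: "\<And>S k a. (S, k) \<in> ontology_predicates T \<Longrightarrow> Atom S (replicate k a) \<in> A \<Longrightarrow>
        subst e \<alpha> \<in> root_model S k \<Longrightarrow> \<forall>v\<in>vars \<alpha>. h v = place S k a (e v) \<and> g v = a \<Longrightarrow> thesis'"
    for \<alpha> thesis'
  proof -
    from h[OF \<alpha>] consider \<beta> where "\<beta> \<in> A" "subst h \<alpha> = subst Inl \<beta>"
      | S k a \<beta> where "(S, k) \<in> ontology_predicates T" "Atom S (replicate k a) \<in> A"
        "\<beta> \<in> root_model S k" "subst h \<alpha> = subst (place S k a) \<beta>"
      unfolding glued_def by blast
    then show thesis'
    proof cases
      case 1
      have args: "map h (args \<alpha>) = map Inl (args \<beta>)" using arg_cong[OF 1(2), of args] by simp
      have hg: "h v = Inl (g v)" if "v \<in> vars \<alpha>" for v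
      proof -
        have "h v \<in> set (map Inl (args \<beta>))" using that unfolding args[symmetric] by simp
        then show ?thesis by (auto simp: g_def)
      qed
      have "map Inl (map g (args \<alpha>)) = (map Inl (args \<beta>) :: (nat + nat \<times> nat \<times> nat \<times> elem) list)"
        using args hg by (simp add: comp_def cong: map_cong)
      then have "map g (args \<alpha>) = args \<beta>" by (simp add: inj_map_eq_map[OF inj_Inl] del: map_map)
      then have "subst g \<alpha> = \<beta>" using arg_cong[OF 1(2), of pname] by (cases \<alpha>, cases \<beta>) simp
      then show ?thesis using data 1(1) hg by blast
    next
      case 2
      have args: "map h (args \<alpha>) = map (place S k a) (args \<beta>)" using arg_cong[OF 2(4), of args] by simp
      have hp: "h v = place S k a (e v) \<and> g v = a" if "v \<in> vars \<alpha>" for v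
      proof -
        have "h v \<in> set (map (place S k a) (args \<beta>))" using that unfolding args[symmetric] by simp
        then obtain d where d: "d \<in> vars \<beta>" "h v = place S k a d" by auto
        then have "e v = d" using unplace_place[OF 2(1,3)] by (simp add: e_def)
        moreover have "g v = a" using d(2) by (simp add: g_def place_def split: elem.splits)
        ultimately show ?thesis using d by simp
      qed
      have "map e (args \<alpha>) = map unplace (map h (args \<alpha>))" by (simp add: e_def)
      also have "\<dots> = args \<beta>" unfolding args using unplace_place[OF 2(1,3)] by (simp add: map_idI)
      finally have "subst e \<alpha> = \<beta>" using arg_cong[OF 2(4), of pname] by (cases \<alpha>, cases \<beta>) simp
      then show ?thesis using root 2(1-3) hp by blast
    qed
  qed
  \<comment> \<open>A tagged null among the arguments determines the copy in which the whole atom is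
    matched.\<close>
  have null: "(S, k) \<in> ontology_predicates T \<and> Atom S (replicate k a) \<in> A \<and> g y = a \<and> e y = n \<and> n \<noteq> Ind 0 \<and>
      subst e \<alpha> \<in> root_model S k \<and> (\<forall>v\<in>vars \<alpha>. h v = place S k a (e v) \<and> g v = a)"
    if \<alpha>: "\<alpha> \<in> set (cq_atoms q)" "y \<in> vars \<alpha>" "h y = Inr (S, k, a, n)" for \<alpha> y S k a n
    using \<alpha>(1)
  proof (rule cases)
    fix S' k' a'
    assume *: "(S', k') \<in> ontology_predicates T" "Atom S' (replicate k' a') \<in> A"
      "subst e \<alpha> \<in> root_model S' k'" "\<forall>v\<in>vars \<alpha>. h v = place S' k' a' (e v) \<and> g v = a'"
    then have "place S' k' a' (e y) = Inr (S, k, a, n)" using \<alpha> by simp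
    then have "S' = S \<and> k' = k \<and> a' = a \<and> e y = n \<and> n \<noteq> Ind 0"
      by (auto simp: place_def split: elem.splits)
    then show ?thesis using * \<alpha>(2) by blast
  qed (use \<alpha> in auto)
  \<comment> \<open>A null next to an individual is a child of the root, and by the depth bound it
    has no other neighbour.\<close>
  have nbr: "h v = Inl (g y) \<and> e v = Ind 0 \<and> g v = g y"
    if yz: "(y, z) \<in> adj" "h y = Inr (S, k, a, n)" "h z = Inl b"
      and v: "\<alpha> \<in> set (cq_atoms q)" "y \<in> vars \<alpha>" "v \<in> vars \<alpha>" "v \<noteq> y"
    for y z S k a n b \<alpha> v
  proof -
    obtain \<beta> where \<beta>: "\<beta> \<in> set (cq_atoms q)" "y \<in> vars \<beta>" "z \<in> vars \<beta>" using yz(1) by (auto simp: adj_def)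
    have ez: "e z = Ind 0" using yz(3) by (simp add: e_def unplace_def)
    note nb = null[OF \<beta>(1,2) yz(2)] and na = null[OF v(1,2) yz(2)]
    have ey: "e y = n" using nb by blast
    have "e v = Ind 0"
    proof (rule leaf_neighbour[where \<alpha> = "subst e \<beta>" and n = n and R = "pname \<alpha>"])
      show "arity (subst e \<beta>) \<in> {1, 2}" using arity_cq_atoms[OF \<beta>(1)] by simp
      show "n \<in> vars (subst e \<beta>)" "Ind 0 \<in> vars (subst e \<beta>)"
        using imageI[OF \<beta>(2), of e] imageI[OF \<beta>(3), of e] by (simp_all add: ey ez)
      have "\<alpha> = Atom (pname \<alpha>) [y, v] \<or> \<alpha> = Atom (pname \<alpha>) [v, y]"
        using atom_of_two_vars[OF arity_cq_atoms[OF v(1)] v(2,3)] v(4) by blast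
      then have "subst e \<alpha> = Atom (pname \<alpha>) [n, e v] \<or> subst e \<alpha> = Atom (pname \<alpha>) [e v, n]"
        using ey by (cases \<alpha>) auto
      moreover have "subst e \<alpha> \<in> root_model S k" using na by blast
      ultimately show "Atom (pname \<alpha>) [n, e v] \<in> root_model S k \<or> Atom (pname \<alpha>) [e v, n] \<in> root_model S k"
        by metis
    qed (use nb in blast)+
    moreover have "h v = place S k a (e v) \<and> g v = a" using na v(3) by blast
    moreover have "g y = a" using na by blast
    ultimately show ?thesis by (simp add: place_def)
  qed
  define ground where "ground v \<longleftrightarrow> (\<exists>b. h v = Inl b)" for v
  \<comment> \<open>Null variables without a ground neighbour are left out; they will turn out to
    lie in components without any ground variable.\<close>
  define I where "I = {y. \<not> ground y \<and> (\<exists>z. (y, z) \<in> adj \<and> ground z)}"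
  have null_form: "\<exists>S k a n. h y = Inr (S, k, a, n)" if "\<not> ground y" for y
    using that unfolding ground_def by (cases "h y") auto
  have ans_ground: "ground v" if "v \<in> set (answer_vars q)" for v
  proof -
    have "h v \<in> set (map h (answer_vars q))" using that by simp
    then show ?thesis unfolding ans ground_def by auto
  qed
  have I_nbr: "ground v \<and> e v = Ind 0 \<and> g v = g y"
    if "y \<in> I" "\<alpha> \<in> set (cq_atoms q)" "y \<in> vars \<alpha>" "v \<in> vars \<alpha>" "v \<noteq> y" for y v \<alpha>
  proof -
    obtain z b S k a n where "(y, z) \<in> adj" "h z = Inl b" "h y = Inr (S, k, a, n)"
      using \<open>y \<in> I\<close> null_form unfolding I_def ground_def by blast
    then show ?thesis using nbr that(2-5) unfolding ground_def by blast
  qed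
  have "match A g I"
    unfolding match_def
  proof (intro conjI ballI)
    show "I \<subseteq> ev"
      using ans_ground by (auto simp: I_def ev_def set_vs adj_def)
  next
    fix y assume y: "y \<in> I"
    obtain S k a n where Sk: "h y = Inr (S, k, a, n)" using y null_form unfolding I_def by blast
    obtain \<beta> where \<beta>: "\<beta> \<in> set (cq_atoms q)" "y \<in> vars \<beta>" using y by (auto simp: I_def adj_def)
    note n = null[OF \<beta> Sk]
    have ey: "e y = n" using n by blast
    \<comment> \<open>Undoes the renaming in \<open>star\<close>: 0 is the null and 1 the
      root.\<close>
    define \<eta> where "\<eta> i = (if i = 0 then n else Ind 0)" for i :: nat
    have "entails_cq T {Atom S (replicate k 0)} (star y) (map (\<lambda>_. 0) [1::nat])"
      unfolding star_def
    proof (rule root_model_entails_cq[where h = \<eta>])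
      fix \<gamma> :: "(nat, nat) atom" assume "\<gamma> \<in> set (map (subst (\<lambda>v. if v = y then 0 else 1)) (filter (\<lambda>\<alpha>. y \<in> vars \<alpha>) (cq_atoms q)))"
      then obtain \<alpha> where \<alpha>: "\<alpha> \<in> set (cq_atoms q)" "y \<in> vars \<alpha>"
        and \<gamma>: "\<gamma> = subst (\<lambda>v. if v = y then 0 else 1) \<alpha>" by auto
      have "subst \<eta> \<gamma> = subst e \<alpha>" unfolding \<gamma> subst_subst
      proof (rule subst_cong)
        fix v assume "v \<in> vars \<alpha>"
        then show "\<eta> (if v = y then 0 else 1) = e v"
          using I_nbr[OF y \<alpha>, of v] ey by (auto simp: \<eta>_def)
      qed
      then show "subst \<eta> \<gamma> \<in> root_model S k \<and> predicate \<gamma> \<noteq> (fresh, 1)"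
        using null[OF \<alpha> Sk] not_fresh[OF \<alpha>(1)] by (simp add: \<gamma>)
    qed (use n in \<open>simp_all add: \<eta>_def\<close>)
    then have "witnessed y S k" using n by (simp add: witnessed_def)
    moreover have "g z = g y" if "(y, z) \<in> adj" for z
      using I_nbr[OF y] that by (auto simp: adj_def)
    ultimately show "tw A g y" using n unfolding tw_def by blast
  next
    fix y z assume "y \<in> I" "z \<in> I"
    then show "(y, z) \<notin> adj" using I_nbr unfolding adj_def I_def by blast
  next
    fix \<alpha> assume \<alpha>: "\<alpha> \<in> set (cq_atoms q)"
    define v where "v = hd (args \<alpha>)"
    have v: "v \<in> vars \<alpha>" using hd_in_vars[OF \<alpha>] by (simp add: v_def)
    show "pa A g \<alpha> \<or> vars \<alpha> \<inter> I \<noteq> {}"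
    proof (cases "\<exists>u. (v, u) \<in> adj\<^sup>* \<and> ground u")
      case True
      then obtain u where u: "(v, u) \<in> adj\<^sup>*" "ground u" by blast
      \<comment> \<open>On a walk from a ground variable, a variable of \<open>I\<close> has ground
        neighbours only, so the walk never goes deeper than one null.\<close>
      have reach: "ground w \<or> w \<in> I" if "(u, w) \<in> adj\<^sup>*" for w
        using that
      proof induction
        case (step w w')
        obtain \<beta> where \<beta>: "\<beta> \<in> set (cq_atoms q)" "w \<in> vars \<beta>" "w' \<in> vars \<beta>" "w \<noteq> w'"
          using step.hyps(2) by (auto simp: adj_def)
        have "(w', w) \<in> adj" using step.hyps(2) sym_adj by (meson symD)
        then show ?case using step.IH I_nbr[OF _ \<beta>(1,2,3)] \<beta>(4) unfolding I_def by blast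
      qed (use u in blast)
      have all: "ground w \<or> w \<in> I" if "w \<in> vars \<alpha>" for w
      proof -
        have "(v, w) \<in> adj\<^sup>*" using atom_vars_connected[OF \<alpha> v that] .
        then show ?thesis using reach connected_iff[OF u(1)] by blast
      qed
      \<comment> \<open>Now all variables of the atom are ground; if it is matched in a copy, it
        sits at the root and completeness applies.\<close>
      have "subst g \<alpha> \<in> A" if "vars \<alpha> \<inter> I = {}"
        using \<alpha>
      proof (rule cases)
        fix S k a
        assume *: "(S, k) \<in> ontology_predicates T" "Atom S (replicate k a) \<in> A"
          "subst e \<alpha> \<in> root_model S k" "\<forall>v\<in>vars \<alpha>. h v = place S k a (e v) \<and> g v = a"
        have "e w = Ind 0" if "w \<in> vars \<alpha>" for w
          using all[OF that] \<open>vars \<alpha> \<inter> I = {}\<close> that by (auto simp: ground_def e_def unplace_def)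
        then have "subst (\<lambda>_. a) (subst e \<alpha>) \<in> A"
          using not_fresh[OF \<alpha>] by (intro root_model_atom_at_root[OF complete *(1-3)]) auto
        moreover have "subst (\<lambda>_. a) (subst e \<alpha>) = subst g \<alpha>"
          unfolding subst_subst using *(4) by (intro subst_cong) simp
        ultimately show ?thesis by simp
      qed
      then show ?thesis by (auto simp: pa_def)
    next
      case False
      obtain S k a n where Sk: "h v = Inr (S, k, a, n)" using False null_form by blast
      note n = null[OF \<alpha> v Sk]
      \<comment> \<open>A component without ground variables stays within one copy, since adjacent
        variables share an atom and a null fixes the copy of its atoms.\<close>
      have same: "\<exists>n. h u = Inr (S, k, a, n)" if "(v, u) \<in> adj\<^sup>*" for u
        using that
      proof induction
        case (step u u')
        then obtain n where n: "h u = Inr (S, k, a, n)" by blast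
        obtain \<beta> where \<beta>: "\<beta> \<in> set (cq_atoms q)" "u \<in> vars \<beta>" "u' \<in> vars \<beta>"
          using step.hyps(2) by (auto simp: adj_def)
        have "h u' = place S k a (e u')" using null[OF \<beta>(1,2) n] \<beta>(3) by blast
        moreover have "\<not> ground u'" using False step.hyps by (meson rtrancl.rtrancl_into_rtrancl)
        ultimately show ?case by (auto simp: place_def ground_def split: elem.splits)
      qed (use Sk in blast)
      have "entails_cq T {Atom S (replicate k 0)} (Cq [] (component v)) (map (\<lambda>_. 0) ([] :: nat list))"
      proof (rule root_model_entails_cq[where h = e])
        fix \<beta> assume "\<beta> \<in> set (component v)"
        then obtain u where \<beta>: "\<beta> \<in> set (cq_atoms q)" "u \<in> vars \<beta>" "(v, u) \<in> adj\<^sup>*"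
          by (auto simp: component_def)
        from same[OF \<beta>(3)] obtain n where "h u = Inr (S, k, a, n)" by blast
        from null[OF \<beta>(1,2) this] not_fresh[OF \<beta>(1)]
        show "subst e \<beta> \<in> root_model S k \<and> predicate \<beta> \<noteq> (fresh, 1)" by blast
      qed (use n in auto)
      moreover have "\<forall>u\<in>set (answer_vars q). (v, u) \<notin> adj\<^sup>*" using False ans_ground by blast
      ultimately have "detached v S k" using n unfolding detached_def by simp
      then show ?thesis using n unfolding pa_def det_def v_def by blast
    qed
  qed
  moreover have "map g (answer_vars q) = as"
  proof -
    have "map g (answer_vars q) = map (\<lambda>d. case d of Inl a \<Rightarrow> a | Inr (_, _, a, _) \<Rightarrow> a) (map h (answer_vars q))"
      by (simp add: g_def)
    then show ?thesis unfolding ans by (simp add: comp_def)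
  qed
  moreover have "\<exists>S bs. (S, length bs) \<in> ontology_predicates T \<union> predicate ` set (cq_atoms q) \<and>
       Atom S bs \<in> A \<and> g v \<in> set bs" if "v \<in> set vs" for v
  proof -
    obtain \<alpha> where \<alpha>: "\<alpha> \<in> set (cq_atoms q)" "v \<in> vars \<alpha>" using \<open>v \<in> set vs\<close> by (auto simp: set_vs)
    show ?thesis
      using \<alpha>(1)
    proof (rule cases)
      assume "subst g \<alpha> \<in> A"
      then have "Atom (pname \<alpha>) (map g (args \<alpha>)) \<in> A" by (cases \<alpha>) simp
      then show ?thesis using \<alpha> by (intro exI[of _ "pname \<alpha>"] exI[of _ "map g (args \<alpha>)"]) auto
    next
      fix S k a
      assume *: "(S, k) \<in> ontology_predicates T" "Atom S (replicate k a) \<in> A"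
        "\<forall>v\<in>vars \<alpha>. h v = place S k a (e v) \<and> g v = a"
      have "k > 0" using arity_ontology_predicates[OF *(1)] by auto
      then show ?thesis using * \<alpha>(2) by (intro exI[of _ S] exI[of _ "replicate k a"]) auto
    qed
  qed
  ultimately show thesis using that by blast
qed

end

section \<open>Reduction to 2-SAT\<close>

text \<open>The classical criterion, for any finite implication graph closed under contraposition; a
  unit clause is an edge from a literal to its negation. For the converse, a consistent set of
  literals closed under implication is grown variable by variable until it decides all of
  \<open>V\<close>.\<close>

lemma two_sat:
  fixes E :: "(('v \<times> bool) \<times> ('v \<times> bool)) set"
  assumes V: "finite V" "E \<subseteq> (V \<times> UNIV) \<times> (V \<times> UNIV)"
    and skew: "\<And>u b v c. ((u, b), (v, c)) \<in> E \<Longrightarrow> ((v, \<not> c), (u, \<not> b)) \<in> E"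
  shows "(\<exists>I\<subseteq>V. \<forall>u b v c. ((u, b), (v, c)) \<in> E \<longrightarrow> (u \<in> I) = b \<longrightarrow> (v \<in> I) = c) \<longleftrightarrow>
    (\<forall>y\<in>V. \<exists>b. ((y, b), (y, \<not> b)) \<notin> E\<^sup>*)"
proof
  assume "\<exists>I\<subseteq>V. \<forall>u b v c. ((u, b), (v, c)) \<in> E \<longrightarrow> (u \<in> I) = b \<longrightarrow> (v \<in> I) = c"
  then obtain I where I: "\<And>u b v c. ((u, b), (v, c)) \<in> E \<Longrightarrow> (u \<in> I) = b \<Longrightarrow> (v \<in> I) = c" by blast
  have path: "(fst m \<in> I) = snd m" if "(l, m) \<in> E\<^sup>*" "(fst l \<in> I) = snd l" for l m
    using that
  proof induction
    case (step m n)
    then show ?case using I by (metis prod.collapse)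
  qed simp
  show "\<forall>y\<in>V. \<exists>b. ((y, b), (y, \<not> b)) \<notin> E\<^sup>*"
  proof
    fix y
    show "\<exists>b. ((y, b), (y, \<not> b)) \<notin> E\<^sup>*"
      using path[of "(y, y \<in> I)" "(y, y \<notin> I)"] by auto
  qed
next
  assume cyc: "\<forall>y\<in>V. \<exists>b. ((y, b), (y, \<not> b)) \<notin> E\<^sup>*"
  define neg :: "'v \<times> bool \<Rightarrow> 'v \<times> bool" where "neg l = (fst l, \<not> snd l)" for l
  have [simp]: "neg (neg l) = l" for l by (simp add: neg_def)
  have skew': "(neg m, neg l) \<in> E\<^sup>*" if "(l, m) \<in> E\<^sup>*" for l m
    using that
  proof induction
    case (step m n)
    have "(neg n, neg m) \<in> E" using skew step.hyps(2) unfolding neg_def by (metis prod.collapse)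
    then show ?case using step.IH by (meson converse_rtrancl_into_rtrancl)
  qed simp
  have "\<exists>S. E `` S \<subseteq> S \<and> (\<forall>l\<in>S. neg l \<notin> S) \<and> (\<forall>y\<in>W. \<exists>b. (y, b) \<in> S)" if "W \<subseteq> V" for W
    using finite_subset[OF that V(1)] that
  proof (induction W rule: finite_induct)
    case empty
    show ?case by (intro exI[of _ "{}"]) simp
  next
    case (insert y W)
    then obtain S where S: "E `` S \<subseteq> S" "\<forall>l\<in>S. neg l \<notin> S" "\<forall>y\<in>W. \<exists>b. (y, b) \<in> S" by auto
    have closed: "m \<in> S" if "(l, m) \<in> E\<^sup>*" "l \<in> S" for l m
      using that S(1) by (induction rule: rtrancl_induct) auto
    show ?case
    proof (cases "\<exists>b. (y, b) \<in> S")
      case True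
      then show ?thesis using S by (intro exI[of _ S]) simp
    next
      case False
      obtain b where "((y, b), (y, \<not> b)) \<notin> E\<^sup>*" using cyc insert.prems by blast
      moreover define l where "l = (y, b)"
      ultimately have l: "(l, neg l) \<notin> E\<^sup>*" by (simp add: neg_def)
      have l_S: "neg l \<notin> S" using False by (simp add: l_def neg_def)
      \<comment> \<open>Contraposition turns the path from \<open>l\<close> to \<open>m\<close> into
        one from \<open>neg m\<close> to \<open>neg l\<close>. So \<open>neg m\<close> in
        \<open>S\<close> would put \<open>neg l\<close> into \<open>S\<close>, and
        \<open>neg m\<close> reachable from \<open>l\<close> would give a path from \<open>l\<close>
        to \<open>neg l\<close>.\<close>
      have R: "neg m \<notin> S \<union> E\<^sup>* `` {l}" if m: "(l, m) \<in> E\<^sup>*" for m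
      proof -
        have n: "(neg m, neg l) \<in> E\<^sup>*" using skew'[OF m] .
        then have "neg m \<notin> S" using closed l_S by blast
        moreover have "(l, neg m) \<notin> E\<^sup>*" using n l by (meson rtrancl_trans)
        ultimately show ?thesis by blast
      qed
      \<comment> \<open>If \<open>neg m\<close> were reachable from \<open>l\<close>, the previous
        fact applied to it would exclude \<open>m\<close> from \<open>S\<close>.\<close>
      have "neg m \<notin> S \<union> E\<^sup>* `` {l}" if m: "m \<in> S" for m
        using R[of "neg m"] S(2) m by auto
      then have "\<forall>m\<in>S \<union> E\<^sup>* `` {l}. neg m \<notin> S \<union> E\<^sup>* `` {l}" using R by blast
      moreover have "E `` (S \<union> E\<^sup>* `` {l}) \<subseteq> S \<union> E\<^sup>* `` {l}"
        using S(1) by (auto intro: rtrancl_into_rtrancl)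
      moreover have "\<forall>z\<in>insert y W. \<exists>b. (z, b) \<in> S \<union> E\<^sup>* `` {l}"
        using S(3) by (auto simp: l_def)
      ultimately show ?thesis by blast
    qed
  qed
  from this[OF subset_refl] obtain S
    where S: "E `` S \<subseteq> S" "\<forall>l\<in>S. neg l \<notin> S" "\<forall>y\<in>V. \<exists>b. (y, b) \<in> S" by blast
  have iff: "(u \<in> {y \<in> V. (y, True) \<in> S}) = b \<longleftrightarrow> (u, b) \<in> S" if "u \<in> V" for u b
  proof -
    have "(u, True) \<in> S \<longleftrightarrow> (u, False) \<notin> S"
      using bspec[OF S(2), of "(u, True)"] bspec[OF S(3) that] unfolding neg_def
      by (metis (full_types) fst_conv snd_conv)
    then show ?thesis using that by (cases b) auto
  qed
  show "\<exists>I\<subseteq>V. \<forall>u b v c. ((u, b), (v, c)) \<in> E \<longrightarrow> (u \<in> I) = b \<longrightarrow> (v \<in> I) = c"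
  proof (intro exI[of _ "{y \<in> V. (y, True) \<in> S}"] conjI allI impI)
    fix u b v c assume e: "((u, b), (v, c)) \<in> E" "(u \<in> {y \<in> V. (y, True) \<in> S}) = b"
    then have "u \<in> V" "v \<in> V" using V(2) by auto
    moreover have "(u, b) \<in> S" using e(2) iff[OF \<open>u \<in> V\<close>] by blast
    then have "(v, c) \<in> S" using e(1) S(1) by blast
    ultimately show "(v \<in> {y \<in> V. (y, True) \<in> S}) = c" using iff[of v c] by blast
  qed blast
qed

section \<open>The implication graph of matches\<close>

context omq
begin

text \<open>The implication graph of the 2-CNF that expresses \<open>match\<close>: the literal \<open>(y, True)\<close> stands for
  \<open>y \<in> I\<close>.\<close>

definition edges :: "data \<Rightarrow> (nat \<Rightarrow> nat) \<Rightarrow> ((nat \<times> bool) \<times> (nat \<times> bool)) set" where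
  "edges A g =
     {((y, True), (z, False)) | y z. y \<in> ev \<and> z \<in> ev \<and> (y, z) \<in> adj} \<union>
     {((y, True), (y, False)) | y. y \<in> ev \<and> \<not> tw A g y} \<union>
     {((y, False), (z, True)) | y z. \<exists>\<alpha>\<in>set (cq_atoms q). \<not> pa A g \<alpha> \<and> vars \<alpha> \<inter> ev = {y, z}}"

lemma edges_subset: "edges A g \<subseteq> (ev \<times> UNIV) \<times> (ev \<times> UNIV)"
  by (auto simp: edges_def)

lemma finite_ev: "finite ev"
  by (simp add: ev_def)

text \<open>The second case allows \<open>y = z\<close>; a failing atom then yields a unit clause,
  the edge from \<open>(y, False)\<close> to \<open>(y, True)\<close>.\<close>

lemma vars_ev_cases:
  assumes "\<alpha> \<in> set (cq_atoms q)"
  obtains "vars \<alpha> \<inter> ev = {}" | y z where "vars \<alpha> \<inter> ev = {y, z}"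
proof -
  have "card (vars \<alpha>) \<le> 2" using arity_cq_atoms[OF assms] card_length[of "args \<alpha>"] by auto
  then have "card (vars \<alpha> \<inter> ev) \<le> 2" using card_mono[of "vars \<alpha>" "vars \<alpha> \<inter> ev"] by simp
  then consider "card (vars \<alpha> \<inter> ev) = 0" | "card (vars \<alpha> \<inter> ev) = 1" | "card (vars \<alpha> \<inter> ev) = 2" by linarith
  then show thesis
  proof cases
    case 1
    then show thesis using that(1) by simp
  next
    case 2
    then obtain y where "vars \<alpha> \<inter> ev = {y}" by (auto simp: card_1_singleton_iff)
    then show thesis using that(2)[of y y] by simp
  next
    case 3
    then show thesis using that(2) by (auto simp: card_2_iff)
  qed
qed

lemma match_iff_edges:
  assumes "I \<subseteq> ev"
  shows "match A g I \<longleftrightarrow>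
    (\<forall>u b v c. ((u, b), (v, c)) \<in> edges A g \<longrightarrow> (u \<in> I) = b \<longrightarrow> (v \<in> I) = c) \<and>
    (\<forall>\<alpha>\<in>set (cq_atoms q). vars \<alpha> \<inter> ev = {} \<longrightarrow> pa A g \<alpha>)"
proof
  assume m: "match A g I"
  show "(\<forall>u b v c. ((u, b), (v, c)) \<in> edges A g \<longrightarrow> (u \<in> I) = b \<longrightarrow> (v \<in> I) = c) \<and>
    (\<forall>\<alpha>\<in>set (cq_atoms q). vars \<alpha> \<inter> ev = {} \<longrightarrow> pa A g \<alpha>)"
  proof (intro conjI allI impI ballI)
    fix u b v c assume e: "((u, b), (v, c)) \<in> edges A g" "(u \<in> I) = b"
    from e(1) consider "b" "\<not> c" "(u, v) \<in> adj" | "b" "\<not> c" "u = v" "\<not> tw A g u"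
      | \<alpha> where "\<not> b" "c" "\<alpha> \<in> set (cq_atoms q)" "\<not> pa A g \<alpha>" "vars \<alpha> \<inter> ev = {u, v}"
      unfolding edges_def by blast
    then show "(v \<in> I) = c"
    proof cases
      case 3
      then have "vars \<alpha> \<inter> I \<noteq> {}" using m unfolding match_def by blast
      then show ?thesis using 3(1,2,5) e(2) assms by auto
    qed (use m e(2) in \<open>auto simp: match_def\<close>)
  next
    fix \<alpha> assume "\<alpha> \<in> set (cq_atoms q)" "vars \<alpha> \<inter> ev = {}"
    then show "pa A g \<alpha>" using m assms unfolding match_def by blast
  qed
next
  assume *: "(\<forall>u b v c. ((u, b), (v, c)) \<in> edges A g \<longrightarrow> (u \<in> I) = b \<longrightarrow> (v \<in> I) = c) \<and>
    (\<forall>\<alpha>\<in>set (cq_atoms q). vars \<alpha> \<inter> ev = {} \<longrightarrow> pa A g \<alpha>)"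
  then have E: "\<And>u b v c. ((u, b), (v, c)) \<in> edges A g \<Longrightarrow> (u \<in> I) = b \<Longrightarrow> (v \<in> I) = c" by blast
  show "match A g I"
    unfolding match_def
  proof (intro conjI ballI)
    show "tw A g y" if "y \<in> I" for y
    proof (rule ccontr)
      assume "\<not> tw A g y"
      then have "((y, True), (y, False)) \<in> edges A g" using that assms by (auto simp: edges_def)
      from E[OF this] show False using that by simp
    qed
    show "(y, z) \<notin> adj" if "y \<in> I" "z \<in> I" for y z
    proof
      assume "(y, z) \<in> adj"
      then have "((y, True), (z, False)) \<in> edges A g" using that assms by (auto simp: edges_def)
      from E[OF this] show False using that by simp
    qed
    show "pa A g \<alpha> \<or> vars \<alpha> \<inter> I \<noteq> {}" if \<alpha>: "\<alpha> \<in> set (cq_atoms q)" for \<alpha>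
    proof (rule vars_ev_cases[OF \<alpha>])
      assume "vars \<alpha> \<inter> ev = {}"
      then show ?thesis using * \<alpha> by blast
    next
      fix y z assume yz: "vars \<alpha> \<inter> ev = {y, z}"
      show ?thesis
      proof (cases "pa A g \<alpha>")
        case False
        then have "((y, False), (z, True)) \<in> edges A g" using \<alpha> yz by (auto simp: edges_def)
        from E[OF this] have "y \<in> I \<or> z \<in> I" by auto
        then show ?thesis using yz by blast
      qed blast
    qed
  qed (use assms in blast)
qed

text \<open>Bounds the number of pairs of literals, hence of edges, and so the length of the paths
  to be considered. It depends on \<open>q\<close> only: the program fixes its number of levels
  before it sees the data.\<close>

definition levels :: nat where
  "levels = (2 * length vs)\<^sup>2"

lemma not_reachable_iff: "(l, m) \<notin> (edges A g)\<^sup>* \<longleftrightarrow> (\<forall>k\<le>levels. (l, m) \<notin> edges A g ^^ k)"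
proof -
  have "card ev \<le> length vs"
    unfolding ev_def using card_length[of vs] card_mono[of "set vs" "set vs - set (answer_vars q)"] by auto
  then have "card ((ev \<times> (UNIV :: bool set)) \<times> (ev \<times> (UNIV :: bool set))) \<le> levels"
    by (simp add: card_cartesian_product levels_def power2_eq_square mult_mono)
  moreover have fin: "finite (edges A g)"
    using finite_subset[OF edges_subset] finite_ev by (simp add: finite_cartesian_product)
  moreover have "card (edges A g) \<le> card ((ev \<times> (UNIV :: bool set)) \<times> (ev \<times> (UNIV :: bool set)))"
    using finite_ev by (intro card_mono edges_subset) simp
  ultimately have "card (edges A g) \<le> levels" by linarith
  have "\<exists>k\<le>levels. (l, m) \<in> edges A g ^^ k" if "(l, m) \<in> (edges A g)\<^sup>*"
  proof -
    have "(l, m) \<in> (\<Union>n\<in>{n. n \<le> card (edges A g)}. edges A g ^^ n)"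
      using that by (simp only: rtrancl_finite_eq_relpow[OF fin])
    then obtain k where "k \<in> {n. n \<le> card (edges A g)}" "(l, m) \<in> edges A g ^^ k" by (rule UN_E)
    then show ?thesis using \<open>card (edges A g) \<le> levels\<close> by (intro exI[of _ k]) simp
  qed
  moreover have "(l, m) \<in> (edges A g)\<^sup>*" if "(l, m) \<in> edges A g ^^ k" for k
    using relpow_imp_rtrancl[OF that] .
  ultimately show ?thesis by blast
qed

text \<open>Reachability is written through bounded powers because the program works level by level.
  Atoms without existential variables stay outside the graph: no choice of \<open>I\<close> can
  repair them.\<close>

definition satisfiable :: "data \<Rightarrow> (nat \<Rightarrow> nat) \<Rightarrow> bool" where
  "satisfiable A g \<longleftrightarrow> (\<forall>y\<in>ev. \<exists>b. \<forall>k\<le>levels. ((y, b), (y, \<not> b)) \<notin> edges A g ^^ k) \<and>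
     (\<forall>\<alpha>\<in>set (cq_atoms q). vars \<alpha> \<inter> ev = {} \<longrightarrow> pa A g \<alpha>)"

lemma match_iff_satisfiable: "(\<exists>I. match A g I) \<longleftrightarrow> satisfiable A g"
proof -
  have skew: "((v, \<not> c), (u, \<not> b)) \<in> edges A g" if "((u, b), (v, c)) \<in> edges A g" for u b v c
    using that sym_adj unfolding edges_def by (auto simp: insert_commute dest: symD)
  let ?closed = "\<lambda>I. \<forall>u b v c. ((u, b), (v, c)) \<in> edges A g \<longrightarrow> (u \<in> I) = b \<longrightarrow> (v \<in> I) = c"
  let ?ground = "\<forall>\<alpha>\<in>set (cq_atoms q). vars \<alpha> \<inter> ev = {} \<longrightarrow> pa A g \<alpha>"
  have "(\<exists>I. match A g I) \<longleftrightarrow> (\<exists>I. I \<subseteq> ev \<and> match A g I)" unfolding match_def by blast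
  also have "\<dots> \<longleftrightarrow> (\<exists>I. I \<subseteq> ev \<and> ?closed I \<and> ?ground)" using match_iff_edges[of _ A g] by (intro ex_cong1) blast
  also have "\<dots> \<longleftrightarrow> (\<exists>I. I \<subseteq> ev \<and> ?closed I) \<and> ?ground" by blast
  also have "(\<exists>I. I \<subseteq> ev \<and> ?closed I) \<longleftrightarrow> (\<forall>y\<in>ev. \<exists>b. ((y, b), (y, \<not> b)) \<notin> (edges A g)\<^sup>*)"
    by (rule two_sat[OF finite_ev edges_subset skew])
  finally show ?thesis unfolding satisfiable_def not_reachable_iff .
qed

end

section \<open>The program\<close>

type_synonym lit = "nat \<times> bool"

text \<open>Absence of paths, unlike their presence, is monotone in the data. \<open>ANonVia k l n m\<close> excludes
  paths of length \<open>k + 1\<close> from \<open>l\<close> to \<open>m\<close> whose last but one literal is \<open>n\<close>.\<close>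

datatype aux_name = ADom | ADet nat | AAtom "(nat, nat) atom" | ATw nat | ANonEdge lit lit
  | ANonPath nat lit lit | ANonVia nat lit lit lit | ANonReach lit lit | AVar nat | AGoal

instance aux_name :: countable by countable_datatype

definition ax :: "aux_name \<Rightarrow> 't list \<Rightarrow> (ndl_name, 't) atom" where
  "ax a ts = Atom (Aux (to_nat a)) ts"

lemma ax_simps [simp]: "pname (ax a ts) = Aux (to_nat a)" "args (ax a ts) = ts"
  by (simp_all add: ax_def)

text \<open>The guards make the clause safe even if its conditions mention few variables of the
  tuple or none.\<close>

definition guarded :: "aux_name \<Rightarrow> nat list \<Rightarrow> (ndl_name, nat) atom list \<Rightarrow> clause" where
  "guarded a ts \<beta>s = Clause (ax a ts) (map (\<lambda>v. ax ADom [v]) ts @ \<beta>s)"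

lemma guarded_simps [simp]: "chead (guarded a ts \<beta>s) = ax a ts"
  "cbody (guarded a ts \<beta>s) = map (\<lambda>v. ax ADom [v]) ts @ \<beta>s"
  by (simp_all add: guarded_def)

context omq
begin

definition preds :: "(nat \<times> nat) set" where
  "preds = ontology_predicates T \<union> predicate ` set (cq_atoms q)"

definition evs :: "nat list" where
  "evs = filter (\<lambda>v. v \<in> ev) vs"

definition lits :: "lit list" where
  "lits = List.product evs [True, False]"

lemma set_evs: "set evs = ev"
  by (auto simp: evs_def ev_def)

lemma set_lits: "set lits = ev \<times> UNIV"
  by (auto simp: lits_def set_evs)

text \<open>Clauses have no equality, so \<open>g z = g y\<close> for the neighbours
  \<open>z\<close> of \<open>y\<close> is imposed by writing \<open>y\<close> in their positions in
  the head.\<close>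

definition merge :: "nat \<Rightarrow> nat \<Rightarrow> nat" where
  "merge y v = (if (y, v) \<in> adj then y else v)"

text \<open>What the data must supply for the edge to be absent. Edges that come from adjacency do
  not depend on the data and are left to \<open>conflict\<close>; pairs that are never joined get
  the empty list.\<close>

definition conditions :: "lit \<Rightarrow> lit \<Rightarrow> aux_name list" where
  "conditions l m =
     (if snd l \<and> \<not> snd m \<and> fst l = fst m then [ATw (fst l)]
      else if \<not> snd l \<and> snd m then map AAtom (filter (\<lambda>\<alpha>. vars \<alpha> \<inter> ev = {fst l, fst m}) (cq_atoms q))
      else [])"

definition conflict :: "lit \<Rightarrow> lit \<Rightarrow> bool" where
  "conflict l m \<longleftrightarrow> snd l \<and> \<not> snd m \<and> (fst l, fst m) \<in> adj"

text \<open>The active domain with respect to \<open>q\<close> and \<open>T\<close>: a finite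
  program cannot name all predicates that data may contain.\<close>

definition dom_clauses :: "clause set" where
  "dom_clauses = {Clause (ax ADom [i]) [Atom (Sig S) [0..<k]] | S k i. (S, k) \<in> preds \<and> i < k}"

definition det_clauses :: "clause set" where
  "det_clauses = {Clause (ax (ADet v) []) [Atom (Sig S) (replicate k 0)] | v S k. v \<in> set vs \<and> detached v S k}"

definition atom_clauses :: "clause set" where
  "atom_clauses = (\<lambda>\<alpha>. guarded (AAtom \<alpha>) vs [map_atom Sig id \<alpha>]) ` set (cq_atoms q) \<union>
     (\<lambda>\<alpha>. guarded (AAtom \<alpha>) vs [ax (ADet (hd (args \<alpha>))) []]) ` set (cq_atoms q)"

definition tw_clauses :: "clause set" where
  "tw_clauses = {guarded (ATw y) (map (merge y) vs) [Atom (Sig S) (replicate k y)] | y S k.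
     y \<in> ev \<and> witnessed y S k}"

definition edge_clauses :: "clause set" where
  "edge_clauses = {guarded (ANonEdge l m) vs (map (\<lambda>a. ax a vs) (conditions l m)) | l m.
     l \<in> set lits \<and> m \<in> set lits \<and> \<not> conflict l m}"

definition path_clauses :: "clause set" where
  "path_clauses =
     {guarded (ANonPath 0 l m) vs [] | l m. l \<in> set lits \<and> m \<in> set lits \<and> l \<noteq> m} \<union>
     {guarded (ANonPath (Suc k) l m) vs (map (\<lambda>n. ax (ANonVia k l n m) vs) lits) | k l m.
        k < levels \<and> l \<in> set lits \<and> m \<in> set lits}"

text \<open>Two clauses for one head express a disjunction. Giving it a predicate of its own keeps
  the program small: expanded inside the conjunction over all \<open>n\<close>, it would cost
  exponentially many clauses.\<close>

definition via_clauses :: "clause set" where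
  "via_clauses =
     {guarded (ANonVia k l n m) vs [ax (ANonPath k l n) vs] | k l n m.
        k < levels \<and> l \<in> set lits \<and> n \<in> set lits \<and> m \<in> set lits} \<union>
     {guarded (ANonVia k l n m) vs [ax (ANonEdge n m) vs] | k l n m.
        k < levels \<and> l \<in> set lits \<and> n \<in> set lits \<and> m \<in> set lits}"

definition reach_clauses :: "clause set" where
  "reach_clauses =
     {guarded (ANonReach l m) vs (map (\<lambda>k. ax (ANonPath k l m) vs) [0..<Suc levels]) | l m.
        l \<in> set lits \<and> m \<in> set lits} \<union>
     {guarded (AVar y) vs [ax (ANonReach (y, b) (y, \<not> b)) vs] | y b. y \<in> ev}"

text \<open>Here the variables of the tuple that are not answer variables are projected away, which
  amounts to guessing \<open>g\<close>.\<close>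

definition goal_clause :: clause where
  "goal_clause = guarded AGoal (answer_vars q) (map (\<lambda>y. ax (AVar y) vs) evs @
     map (\<lambda>\<alpha>. ax (AAtom \<alpha>) vs) (filter (\<lambda>\<alpha>. vars \<alpha> \<inter> ev = {}) (cq_atoms q)))"

definition program :: "clause set" where
  "program = insert goal_clause (dom_clauses \<union> det_clauses \<union> atom_clauses \<union> tw_clauses \<union> edge_clauses \<union>
     path_clauses \<union> via_clauses \<union> reach_clauses)"

lemmas clauses_defs = dom_clauses_def det_clauses_def atom_clauses_def tw_clauses_def edge_clauses_def
  path_clauses_def via_clauses_def reach_clauses_def

section \<open>Soundness by an intended model\<close>

fun sem :: "data \<Rightarrow> (nat \<Rightarrow> nat) \<Rightarrow> aux_name \<Rightarrow> bool" where
  "sem A g (AAtom \<alpha>) \<longleftrightarrow> pa A g \<alpha>"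
| "sem A g (ATw y) \<longleftrightarrow> tw A g y"
| "sem A g (ANonEdge l m) \<longleftrightarrow> (l, m) \<notin> edges A g"
| "sem A g (ANonPath k l m) \<longleftrightarrow> (l, m) \<notin> edges A g ^^ k"
| "sem A g (ANonVia k l n m) \<longleftrightarrow> (l, n) \<notin> edges A g ^^ k \<or> (n, m) \<notin> edges A g"
| "sem A g (ANonReach l m) \<longleftrightarrow> (\<forall>k\<le>levels. (l, m) \<notin> edges A g ^^ k)"
| "sem A g (AVar y) \<longleftrightarrow> (\<exists>b. \<forall>k\<le>levels. ((y, b), (y, \<not> b)) \<notin> edges A g ^^ k)"
| "sem A g _ \<longleftrightarrow> True"

lemma edge_iff:
  assumes "l \<in> set lits" "m \<in> set lits"
  shows "(l, m) \<notin> edges A g \<longleftrightarrow> \<not> conflict l m \<and> (\<forall>a\<in>set (conditions l m). sem A g a)"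
proof -
  obtain y b z c where lm: "l = (y, b)" "m = (z, c)" by (metis prod.collapse)
  have "y \<in> ev" "z \<in> ev" using assms by (auto simp: lm set_lits)
  moreover have "(y, y) \<notin> adj" by (simp add: adj_def)
  ultimately show ?thesis
    unfolding edges_def conflict_def conditions_def lm by (cases b; cases c) auto
qed

lemma nonpath_Suc_iff:
  assumes "l \<in> set lits" "m \<in> set lits"
  shows "sem A g (ANonPath (Suc k) l m) \<longleftrightarrow> (\<forall>n\<in>set lits. sem A g (ANonVia k l n m))"
  using edges_subset[of A g] by (auto simp: set_lits relcomp_unfold)

text \<open>A tuple over \<open>vs\<close> determines a function on \<open>vs\<close> only; the
  fixed value 0 elsewhere makes that function unique.\<close>

definition restr :: "(nat \<Rightarrow> nat) \<Rightarrow> nat \<Rightarrow> nat" where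
  "restr g v = (if v \<in> set vs then g v else 0)"

text \<open>Soundness needs some model of the program, not the least one, so \<open>ADom\<close> may
  hold everywhere.\<close>

definition meaning :: "data \<Rightarrow> aux_name \<Rightarrow> nat list set" where
  "meaning A a = (case a of ADom \<Rightarrow> UNIV | ADet v \<Rightarrow> {ds. det A v}
     | AGoal \<Rightarrow> {map g (answer_vars q) | g. satisfiable A g}
     | _ \<Rightarrow> {map g vs | g. sem A (restr g) a})"

definition intended :: "data \<Rightarrow> (ndl_name, nat) interp" where
  "intended A = \<lparr>Dom = UNIV, Con = id,
     Rel = (\<lambda>P. case P of Sig S \<Rightarrow> {ds. Atom S ds \<in> A} | Aux i \<Rightarrow> meaning A (from_nat i))\<rparr>"

lemma intended_simps [simp]: "Dom (intended A) = UNIV" "Con (intended A) = id"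
  by (simp_all add: intended_def)

lemma holds_intended_Sig [simp]:
  "holds (intended A) h (map_atom Sig id \<alpha>) \<longleftrightarrow> subst h \<alpha> \<in> A"
  "holds (intended A) h (Atom (Sig S) ts) \<longleftrightarrow> Atom S (map h ts) \<in> A"
  by (cases \<alpha>; simp add: holds_def intended_def)+

lemma map_vs_eq_iff: "map g vs = map h vs \<longleftrightarrow> restr g = restr h"
  by (auto simp: restr_def fun_eq_iff)

lemma holds_intended_ax:
  "holds (intended A) h (ax a ts) \<longleftrightarrow> map h ts \<in> meaning A a"
  by (simp add: holds_def intended_def)

lemma map_meaning_iff:
  assumes "a \<notin> {ADom, AGoal} \<union> range ADet"
  shows "map h vs \<in> meaning A a \<longleftrightarrow> sem A (restr h) a"
proof -
  have "meaning A a = {map g vs | g. sem A (restr g) a}"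
    using assms by (cases a) (simp_all add: meaning_def)
  then show ?thesis using map_vs_eq_iff by auto
qed

lemma map_meaning [simp]:
  "map h vs \<in> meaning A (AAtom \<alpha>) \<longleftrightarrow> sem A (restr h) (AAtom \<alpha>)"
  "map h vs \<in> meaning A (ATw y) \<longleftrightarrow> sem A (restr h) (ATw y)"
  "map h vs \<in> meaning A (ANonEdge l m) \<longleftrightarrow> sem A (restr h) (ANonEdge l m)"
  "map h vs \<in> meaning A (ANonPath k l m) \<longleftrightarrow> sem A (restr h) (ANonPath k l m)"
  "map h vs \<in> meaning A (ANonVia k l n m) \<longleftrightarrow> sem A (restr h) (ANonVia k l n m)"
  "map h vs \<in> meaning A (ANonReach l m) \<longleftrightarrow> sem A (restr h) (ANonReach l m)"
  "map h vs \<in> meaning A (AVar y) \<longleftrightarrow> sem A (restr h) (AVar y)"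
  by (simp_all add: map_meaning_iff image_iff)

lemma meaning_ADet [simp]: "ds \<in> meaning A (ADet v) \<longleftrightarrow> det A v"
  by (simp add: meaning_def)

lemma sat_guarded_intended:
  assumes "\<And>h. (\<And>\<beta>. \<beta> \<in> set \<beta>s \<Longrightarrow> holds (intended A) h \<beta>) \<Longrightarrow> map h ts \<in> meaning A a"
  shows "sat_clause (intended A) (guarded a ts \<beta>s)"
  using assms by (auto simp: sat_clause_def holds_intended_ax)

lemma subst_restr: "\<alpha> \<in> set (cq_atoms q) \<Longrightarrow> subst (restr h) \<alpha> = subst h \<alpha>"
  by (intro subst_cong) (auto simp: restr_def set_vs)

lemma adj_vs: "(y, z) \<in> adj \<Longrightarrow> y \<in> set vs \<and> z \<in> set vs"
  by (auto simp: adj_def set_vs)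

lemma sat_program_intended: "\<forall>c\<in>program. sat_clause (intended A) c"
proof -
  have "sat_clause (intended A) goal_clause"
    unfolding goal_clause_def
  proof (rule sat_guarded_intended)
    fix h
    assume *: "\<And>\<beta>. \<beta> \<in> set (map (\<lambda>y. ax (AVar y) vs) evs @
       map (\<lambda>\<alpha>. ax (AAtom \<alpha>) vs) (filter (\<lambda>\<alpha>. vars \<alpha> \<inter> ev = {}) (cq_atoms q))) \<Longrightarrow> holds (intended A) h \<beta>"
    have "sem A (restr h) (AVar y)" if "y \<in> ev" for y
      using *[of "ax (AVar y) vs"] that by (simp add: holds_intended_ax set_evs del: sem.simps)
    moreover have "sem A (restr h) (AAtom \<alpha>)" if "\<alpha> \<in> set (cq_atoms q)" "vars \<alpha> \<inter> ev = {}" for \<alpha>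
      using *[of "ax (AAtom \<alpha>) vs"] that by (simp add: holds_intended_ax del: sem.simps)
    ultimately have "satisfiable A (restr h)" by (simp add: satisfiable_def)
    moreover have "map h (answer_vars q) = map (restr h) (answer_vars q)"
      using cq by (auto simp: restr_def is_cq_def set_vs)
    ultimately show "map h (answer_vars q) \<in> meaning A AGoal" by (auto simp: meaning_def)
  qed
  moreover have "sat_clause (intended A) c" if "c \<in> dom_clauses" for c
    using that by (auto simp: dom_clauses_def sat_clause_def holds_intended_ax meaning_def)
  moreover have "sat_clause (intended A) c" if "c \<in> det_clauses" for c
  proof -
    obtain v S k where c: "c = Clause (ax (ADet v) []) [Atom (Sig S) (replicate k 0)]" "detached v S k"
      using \<open>c \<in> det_clauses\<close> unfolding det_clauses_def by blast
    then have "det A v" if "Atom S (replicate k a) \<in> A" for a using that unfolding det_def by blast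
    then show ?thesis by (simp add: c sat_clause_def holds_intended_ax)
  qed
  moreover have "sat_clause (intended A) c" if "c \<in> atom_clauses" for c
    using that unfolding atom_clauses_def
    by (auto intro!: sat_guarded_intended simp: holds_intended_ax pa_def subst_restr)
  moreover have "sat_clause (intended A) c" if "c \<in> tw_clauses" for c
  proof -
    obtain y S k where c: "c = guarded (ATw y) (map (merge y) vs) [Atom (Sig S) (replicate k y)]"
      and y: "y \<in> ev" "witnessed y S k" using \<open>c \<in> tw_clauses\<close> unfolding tw_clauses_def by blast
    show ?thesis unfolding c
    proof (rule sat_guarded_intended)
      fix h assume "\<And>\<beta>. \<beta> \<in> set [Atom (Sig S) (replicate k y)] \<Longrightarrow> holds (intended A) h \<beta>"
      then have a: "Atom S (replicate k (h y)) \<in> A" by simp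
      \<comment> \<open>The head tuple is \<open>h\<close> composed with \<open>merge y\<close>,
        under which all neighbours of \<open>y\<close> take the value \<open>h y\<close>.\<close>
      define g where "g = restr (\<lambda>v. h (merge y v))"
      have "g y = h y" using y(1) by (simp add: g_def restr_def merge_def ev_def)
      moreover have "g z = h y" if "(y, z) \<in> adj" for z
        using adj_vs[OF that] that by (simp add: g_def restr_def merge_def)
      ultimately have "tw A g y" using y(2) a unfolding tw_def by metis
      then show "map h (map (merge y) vs) \<in> meaning A (ATw y)"
        using map_meaning(2)[of "\<lambda>v. h (merge y v)"] by (simp add: g_def comp_def)
    qed
  qed
  moreover have "sat_clause (intended A) c" if "c \<in> edge_clauses" for c
  proof -
    obtain l m where c: "c = guarded (ANonEdge l m) vs (map (\<lambda>a. ax a vs) (conditions l m))"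
      and lm: "l \<in> set lits" "m \<in> set lits" "\<not> conflict l m"
      using \<open>c \<in> edge_clauses\<close> unfolding edge_clauses_def by blast
    show ?thesis unfolding c
    proof (rule sat_guarded_intended)
      fix h assume *: "\<And>\<beta>. \<beta> \<in> set (map (\<lambda>a. ax a vs) (conditions l m)) \<Longrightarrow> holds (intended A) h \<beta>"
      have "sem A (restr h) a" if "a \<in> set (conditions l m)" for a
      proof -
        have "map h vs \<in> meaning A a" using *[of "ax a vs"] that by (simp add: holds_intended_ax)
        moreover have "a \<notin> {ADom, AGoal} \<union> range ADet"
          using that by (auto simp: conditions_def split: if_splits)
        ultimately show ?thesis using map_meaning_iff by blast
      qed
      then show "map h vs \<in> meaning A (ANonEdge l m)" using edge_iff[OF lm(1,2)] lm(3) by simp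
    qed
  qed
  moreover have "sat_clause (intended A) c" if "c \<in> path_clauses" for c
  proof -
    from that consider l m where "c = guarded (ANonPath 0 l m) vs []" "l \<noteq> m"
      | k l m where "c = guarded (ANonPath (Suc k) l m) vs (map (\<lambda>n. ax (ANonVia k l n m) vs) lits)"
        "l \<in> set lits" "m \<in> set lits"
      unfolding path_clauses_def by blast
    then show ?thesis
    proof cases
      case 1
      then show ?thesis by (auto intro: sat_guarded_intended)
    next
      case 2
      show ?thesis unfolding 2(1)
      proof (rule sat_guarded_intended)
        fix h assume *: "\<And>\<beta>. \<beta> \<in> set (map (\<lambda>n. ax (ANonVia k l n m) vs) lits) \<Longrightarrow> holds (intended A) h \<beta>"
        have "sem A (restr h) (ANonVia k l n m)" if "n \<in> set lits" for n
          using *[of "ax (ANonVia k l n m) vs"] that by (simp add: holds_intended_ax del: sem.simps)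
        then show "map h vs \<in> meaning A (ANonPath (Suc k) l m)"
          using nonpath_Suc_iff[OF 2(2,3)] by (simp del: sem.simps)
      qed
    qed
  qed
  moreover have "sat_clause (intended A) c" if "c \<in> via_clauses" for c
    using that unfolding via_clauses_def
    by (auto intro!: sat_guarded_intended simp: holds_intended_ax)
  moreover have "sat_clause (intended A) c" if "c \<in> reach_clauses" for c
  proof -
    from that consider l m where "c = guarded (ANonReach l m) vs (map (\<lambda>k. ax (ANonPath k l m) vs) [0..<Suc levels])"
      | y b where "c = guarded (AVar y) vs [ax (ANonReach (y, b) (y, \<not> b)) vs]"
      unfolding reach_clauses_def by blast
    then show ?thesis
    proof cases
      case 1
      show ?thesis unfolding 1
      proof (rule sat_guarded_intended)
        fix h assume *: "\<And>\<beta>. \<beta> \<in> set (map (\<lambda>k. ax (ANonPath k l m) vs) [0..<Suc levels]) \<Longrightarrow> holds (intended A) h \<beta>"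
        have "sem A (restr h) (ANonPath k l m)" if "k \<le> levels" for k
        proof -
          have "ax (ANonPath k l m) vs \<in> set (map (\<lambda>k. ax (ANonPath k l m) vs) [0..<Suc levels])"
            unfolding set_map set_upt by (rule imageI) (use that in simp)
          from *[OF this] show ?thesis by (simp add: holds_intended_ax)
        qed
        then show "map h vs \<in> meaning A (ANonReach l m)" by simp
      qed
    next
      case 2
      show ?thesis unfolding 2
        by (rule sat_guarded_intended) (auto simp: holds_intended_ax)
    qed
  qed
  ultimately show ?thesis unfolding program_def by blast
qed

text \<open>Evaluating the goal in the intended model gives a \<open>g\<close> whose 2-CNF is
  satisfiable, hence a match, which is sound.\<close>

lemma program_sound:
  assumes "datalog_entails program A (Atom (Aux (to_nat AGoal)) as)"
  shows "entails_cq T A q as"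
proof -
  have "is_interp (intended A)" by (auto simp: is_interp_def)
  moreover have "sat_data (intended A) (map_atom Sig id ` A)"
  proof -
    have "subst id \<alpha> = \<alpha>" for \<alpha> :: "(nat, nat) atom" by (simp add: atom.map_id)
    then show ?thesis by (simp add: sat_data_def)
  qed
  ultimately have "holds (intended A) (Con (intended A)) (Atom (Aux (to_nat AGoal)) as)"
    using datalog_entailsD[OF assms] sat_program_intended by blast
  then obtain g where "as = map g (answer_vars q)" "satisfiable A g"
    by (auto simp: holds_def intended_def meaning_def)
  then show ?thesis using match_sound match_iff_satisfiable by metis
qed

text \<open>The clauses are fired from the data upwards in an arbitrary model \<open>N\<close>. All
  conditions are read off \<open>A\<close> and \<open>g\<close>, never off \<open>N\<close>, which
  may identify constants; only the truth of atoms is carried over along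
  \<open>Con N\<close>.\<close>

lemma program_derives:
  assumes N: "is_interp N" "\<forall>c\<in>program. sat_clause N c" "sat_data N (map_atom Sig id ` A)"
    and dom: "\<And>v. v \<in> set vs \<Longrightarrow> \<exists>S bs. (S, length bs) \<in> preds \<and> Atom S bs \<in> A \<and> g v \<in> set bs"
    and sat: "satisfiable A g"
  shows "holds N (Con N) (ax AGoal (map g (answer_vars q)))"
proof -
  define H where "H = (\<lambda>v. Con N (g v))"
  have con: "Con N a \<in> Dom N" for a using N(1) by (auto simp: is_interp_def)
  have data: "map (Con N) bs \<in> Rel N (Sig S)" if "Atom S bs \<in> A" for S bs
    using bspec[OF N(3)[unfolded sat_data_def] imageI[OF that]] by (simp add: holds_def)
  have fire: "holds N (\<lambda>v. Con N (f v)) (chead c)"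
    if "c \<in> program" "\<And>\<beta>. \<beta> \<in> set (cbody c) \<Longrightarrow> holds N (\<lambda>v. Con N (f v)) \<beta>" for c f
  proof -
    have "range (\<lambda>v. Con N (f v)) \<subseteq> Dom N" using con by auto
    moreover have "\<forall>\<beta>\<in>set (cbody c). holds N (\<lambda>v. Con N (f v)) \<beta>" using that(2) by blast
    ultimately show ?thesis using bspec[OF N(2) that(1)] unfolding sat_clause_def by simp
  qed
  have D: "[H v] \<in> Rel N (Aux (to_nat ADom))" if "v \<in> set vs" for v
  proof -
    obtain S bs where S: "(S, length bs) \<in> preds" "Atom S bs \<in> A" "g v \<in> set bs" using dom \<open>v \<in> set vs\<close> by blast
    then obtain i where i: "i < length bs" "bs ! i = g v" by (metis in_set_conv_nth)
    \<comment> \<open>Variable \<open>j\<close> is sent to the \<open>j\<close>-th argument. Beyond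
      the length \<open>(!) bs\<close> is unspecified, but every \<open>Con N\<close> value lies in
      the domain.\<close>
    let ?c = "Clause (ax ADom [i]) [Atom (Sig S) [0..<length bs]]"
    have "?c \<in> program" using S(1) i(1) unfolding program_def dom_clauses_def by blast
    moreover have "map (\<lambda>j. Con N (bs ! j)) [0..<length bs] = map (Con N) (map ((!) bs) [0..<length bs])"
      by simp
    then have "map (\<lambda>j. Con N (bs ! j)) [0..<length bs] = map (Con N) bs" unfolding map_nth .
    then have "holds N (\<lambda>j. Con N (bs ! j)) (Atom (Sig S) [0..<length bs])"
      using data[OF S(2)] by (simp add: holds_def)
    ultimately show ?thesis using fire[of ?c "(!) bs"] i(2) by (simp add: holds_def H_def)
  qed
  have guard_on: "holds N H (ax a ts)"
    if c: "guarded a ts \<beta>s \<in> program" "set ts \<subseteq> set vs" "\<And>\<beta>. \<beta> \<in> set \<beta>s \<Longrightarrow> holds N H \<beta>" for a ts \<beta>s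
  proof -
    have "holds N H \<beta>" if "\<beta> \<in> set (cbody (guarded a ts \<beta>s))" for \<beta>
    proof -
      from that consider v where "\<beta> = ax ADom [v]" "v \<in> set ts" | "\<beta> \<in> set \<beta>s" by auto
      then show ?thesis
      proof cases
        case 1
        then show ?thesis using D[of v] c(2) by (simp add: holds_def subset_iff)
      qed (rule c(3))
    qed
    then show ?thesis using fire[OF c(1), of g] unfolding H_def by simp
  qed
  note guard = guard_on[OF _ subset_refl]
  have guard1: "holds N H (ax a vs)" if "guarded a vs [\<beta>] \<in> program" "holds N H \<beta>" for a \<beta>
    using that(2) by (intro guard[OF that(1)]) simp
  have det: "[] \<in> Rel N (Aux (to_nat (ADet v)))" if v: "v \<in> set vs" "det A v" for v
  proof -
    obtain S k a where S: "detached v S k" "Atom S (replicate k a) \<in> A" using v(2) by (auto simp: det_def)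
    let ?c = "Clause (ax (ADet v) []) [Atom (Sig S) (replicate k 0)]"
    have "?c \<in> program" using S(1) v(1) unfolding program_def det_clauses_def by blast
    from fire[OF this, of "\<lambda>_. a"] show ?thesis using data[OF S(2)] by (simp add: holds_def)
  qed
  have atom: "holds N H (ax (AAtom \<alpha>) vs)" if \<alpha>: "\<alpha> \<in> set (cq_atoms q)" "pa A g \<alpha>" for \<alpha>
    using \<alpha>(2) unfolding pa_def
  proof
    assume "subst g \<alpha> \<in> A"
    then have "Atom (pname \<alpha>) (map g (args \<alpha>)) \<in> A" by (cases \<alpha>) simp
    from data[OF this] have "holds N H (map_atom Sig id \<alpha>)"
      by (simp add: holds_def H_def atom.map_sel comp_def)
    moreover have "guarded (AAtom \<alpha>) vs [map_atom Sig id \<alpha>] \<in> program"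
      using \<alpha>(1) unfolding program_def atom_clauses_def by blast
    ultimately show ?thesis using guard1 by blast
  next
    assume "det A (hd (args \<alpha>))"
    moreover have "hd (args \<alpha>) \<in> set vs" using hd_in_vars[OF \<alpha>(1)] \<alpha>(1) by (auto simp: set_vs)
    ultimately have "holds N H (ax (ADet (hd (args \<alpha>))) [])" using det by (simp add: holds_def)
    moreover have "guarded (AAtom \<alpha>) vs [ax (ADet (hd (args \<alpha>))) []] \<in> program"
      using \<alpha>(1) unfolding program_def atom_clauses_def by blast
    ultimately show ?thesis using guard1 by blast
  qed
  have tw: "holds N H (ax (ATw y) vs)" if y: "y \<in> ev" "tw A g y" for y
  proof -
    obtain S k where S: "witnessed y S k" "Atom S (replicate k (g y)) \<in> A"
      and nb: "\<And>z. (y, z) \<in> adj \<Longrightarrow> g z = g y" using y(2) unfolding tw_def by blast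
    let ?c = "guarded (ATw y) (map (merge y) vs) [Atom (Sig S) (replicate k y)]"
    have c: "?c \<in> program" using S(1) y(1) unfolding program_def tw_clauses_def by blast
    \<comment> \<open>As \<open>g\<close> agrees on \<open>y\<close> and its neighbours, the merged
      head tuple is the tuple for \<open>vs\<close>.\<close>
    have m: "H (merge y v) = H v" for v using nb by (simp add: merge_def H_def)
    have "holds N H (Atom (Sig S) (replicate k y))" using data[OF S(2)] by (simp add: holds_def H_def)
    moreover have "set (map (merge y) vs) \<subseteq> set vs"
      using y(1) by (auto simp: merge_def ev_def)
    ultimately have "holds N H (ax (ATw y) (map (merge y) vs))"
      by (intro guard_on[OF c]) auto
    then show ?thesis by (simp add: holds_def comp_def m)
  qed
  have edge: "holds N H (ax (ANonEdge l m) vs)"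
    if lm: "l \<in> set lits" "m \<in> set lits" "(l, m) \<notin> edges A g" for l m
  proof (rule guard)
    have c: "\<not> conflict l m" "\<forall>a\<in>set (conditions l m). sem A g a" using edge_iff[OF lm(1,2)] lm(3) by blast+
    then show "guarded (ANonEdge l m) vs (map (\<lambda>a. ax a vs) (conditions l m)) \<in> program"
      using lm(1,2) unfolding program_def edge_clauses_def by blast
    fix \<beta> assume "\<beta> \<in> set (map (\<lambda>a. ax a vs) (conditions l m))"
    then obtain a where a: "\<beta> = ax a vs" "a \<in> set (conditions l m)" by auto
    then consider "a = ATw (fst l)" | \<alpha> where "a = AAtom \<alpha>" "\<alpha> \<in> set (cq_atoms q)"
      by (auto simp: conditions_def split: if_splits)
    then show "holds N H \<beta>"
    proof cases
      case 1
      then show ?thesis using a c(2) tw[of "fst l"] lm(1) by (auto simp: set_lits)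
    next
      case 2
      then show ?thesis using a c(2) atom by auto
    qed
  qed
  have path: "k \<le> levels \<Longrightarrow> l \<in> set lits \<Longrightarrow> m \<in> set lits \<Longrightarrow> (l, m) \<notin> edges A g ^^ k \<Longrightarrow>
    holds N H (ax (ANonPath k l m) vs)" for k l m
  proof (induction k arbitrary: l m)
    case 0
    have "guarded (ANonPath 0 l m) vs [] \<in> program"
      using 0(2,3) \<open>(l, m) \<notin> edges A g ^^ 0\<close> unfolding program_def path_clauses_def relpow.simps(1)
      by blast
    then show ?case by (rule guard) simp
  next
    case (Suc k)
    show ?case
    proof (rule guard)
      show "guarded (ANonPath (Suc k) l m) vs (map (\<lambda>n. ax (ANonVia k l n m) vs) lits) \<in> program"
        using Suc.prems unfolding program_def path_clauses_def by (blast intro: Suc_le_lessD)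
      fix \<beta> assume "\<beta> \<in> set (map (\<lambda>n. ax (ANonVia k l n m) vs) lits)"
      then obtain n where n: "\<beta> = ax (ANonVia k l n m) vs" "n \<in> set lits" by auto
      have k: "k < levels" using Suc.prems(1) by simp
      have "sem A g (ANonVia k l n m)"
        using nonpath_Suc_iff[OF Suc.prems(2,3), of A g k] Suc.prems(4) n(2) by simp
      then consider "(l, n) \<notin> edges A g ^^ k" | "(n, m) \<notin> edges A g" by auto
      then show "holds N H \<beta>"
      proof cases
        case 1
        have "guarded (ANonVia k l n m) vs [ax (ANonPath k l n) vs] \<in> program"
          using k n(2) Suc.prems(2,3) unfolding program_def via_clauses_def by blast
        then show ?thesis unfolding n(1)
          by (rule guard1) (use Suc.IH[OF _ Suc.prems(2) n(2) 1] k in simp)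
      next
        case 2
        have "guarded (ANonVia k l n m) vs [ax (ANonEdge n m) vs] \<in> program"
          using k n(2) Suc.prems(2,3) unfolding program_def via_clauses_def by blast
        then show ?thesis unfolding n(1) by (rule guard1) (rule edge[OF n(2) Suc.prems(3) 2])
      qed
    qed
  qed
  have var: "holds N H (ax (AVar y) vs)" if y: "y \<in> ev" for y
  proof -
    obtain b where b: "\<forall>k\<le>levels. ((y, b), (y, \<not> b)) \<notin> edges A g ^^ k"
      using sat y unfolding satisfiable_def by blast
    have l: "(y, b) \<in> set lits" "(y, \<not> b) \<in> set lits" using y by (simp_all add: set_lits)
    have "holds N H (ax (ANonReach (y, b) (y, \<not> b)) vs)"
    proof (rule guard)
      show "guarded (ANonReach (y, b) (y, \<not> b)) vs
          (map (\<lambda>k. ax (ANonPath k (y, b) (y, \<not> b)) vs) [0..<Suc levels]) \<in> program"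
        using l unfolding program_def reach_clauses_def by blast
      fix \<beta> assume "\<beta> \<in> set (map (\<lambda>k. ax (ANonPath k (y, b) (y, \<not> b)) vs) [0..<Suc levels])"
      then obtain k where "\<beta> = ax (ANonPath k (y, b) (y, \<not> b)) vs" "k \<le> levels"
        by (auto simp del: upt_Suc)
      then show "holds N H \<beta>" using path l b by blast
    qed
    moreover have "guarded (AVar y) vs [ax (ANonReach (y, b) (y, \<not> b)) vs] \<in> program"
      using y unfolding program_def reach_clauses_def by blast
    ultimately show ?thesis using guard1 by blast
  qed
  have "holds N H (ax AGoal (answer_vars q))"
  proof (rule guard_on)
    show "guarded AGoal (answer_vars q) (map (\<lambda>y. ax (AVar y) vs) evs @
        map (\<lambda>\<alpha>. ax (AAtom \<alpha>) vs) (filter (\<lambda>\<alpha>. vars \<alpha> \<inter> ev = {}) (cq_atoms q))) \<in> program"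
      by (simp add: program_def goal_clause_def)
    show "set (answer_vars q) \<subseteq> set vs" using cq by (simp add: is_cq_def set_vs)
    fix \<beta> assume "\<beta> \<in> set (map (\<lambda>y. ax (AVar y) vs) evs @
        map (\<lambda>\<alpha>. ax (AAtom \<alpha>) vs) (filter (\<lambda>\<alpha>. vars \<alpha> \<inter> ev = {}) (cq_atoms q)))"
    then consider y where "\<beta> = ax (AVar y) vs" "y \<in> ev"
      | \<alpha> where "\<beta> = ax (AAtom \<alpha>) vs" "\<alpha> \<in> set (cq_atoms q)" "vars \<alpha> \<inter> ev = {}"
      by (auto simp: set_evs)
    then show "holds N H \<beta>"
    proof cases
      case 1
      then show ?thesis using var by simp
    next
      case 2
      then have "pa A g \<alpha>" using sat unfolding satisfiable_def by blast
      then show ?thesis using atom[OF 2(2)] 2(1) by simp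
    qed
  qed
  then show ?thesis by (simp add: holds_def H_def comp_def)
qed

end

section \<open>Acyclicity and size\<close>

lemma sum_list_arity_le:
  assumes "\<And>\<alpha>. \<alpha> \<in> set \<alpha>s \<Longrightarrow> arity \<alpha> \<le> B"
  shows "(\<Sum>\<alpha>\<leftarrow>\<alpha>s. 1 + arity \<alpha>) \<le> length \<alpha>s * (1 + B)"
proof -
  have "(\<Sum>\<alpha>\<leftarrow>\<alpha>s. 1 + arity \<alpha>) \<le> (\<Sum>\<alpha>\<leftarrow>\<alpha>s. 1 + B)"
    using assms by (intro sum_list_mono) simp
  then show ?thesis by (simp add: sum_list_triv)
qed

text \<open>Finiteness is carried along because \<open>card\<close> of an infinite set is 0, so that
  a bound on \<open>card\<close> alone would say nothing.\<close>

definition card_bound :: "'a set \<Rightarrow> nat \<Rightarrow> bool" where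
  "card_bound X n \<longleftrightarrow> finite X \<and> card X \<le> n"

lemma card_bound_Un: "card_bound X i \<Longrightarrow> card_bound Y j \<Longrightarrow> card_bound (X \<union> Y) (i + j)"
  unfolding card_bound_def by (meson add_mono card_Un_le finite_UnI order_trans)

lemma card_bound_Times: "card_bound X i \<Longrightarrow> card_bound Y j \<Longrightarrow> card_bound (X \<times> Y) (i * j)"
  unfolding card_bound_def by (simp add: card_cartesian_product mult_mono)

lemma card_bound_subset_image: "X \<subseteq> f ` Y \<Longrightarrow> card_bound Y n \<Longrightarrow> card_bound X n"
  unfolding card_bound_def
  by (meson card_image_le card_mono finite_imageI finite_subset order_trans)

lemma card_bound_mono: "card_bound X i \<Longrightarrow> i \<le> j \<Longrightarrow> card_bound X j"
  by (simp add: card_bound_def)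

lemma card_bound_set: "card_bound (set xs) (length xs)"
  by (simp add: card_bound_def card_length)

lemma card_bound_UNION:
  assumes "finite I" "\<And>i. i \<in> I \<Longrightarrow> card_bound (X i) (f i)"
  shows "card_bound (\<Union>i\<in>I. X i) (\<Sum>i\<in>I. f i)"
  using assms
  by (auto simp: card_bound_def intro!: order_trans[OF card_UN_le] sum_mono)

lemma card_bound_ontology_predicates:
  assumes "finite T"
  shows "card_bound (ontology_predicates T) (ontology_size T)"
  unfolding ontology_predicates_def ontology_size_def
proof (rule card_bound_UNION[OF assms])
  fix \<tau>
  have "card_bound (set (body \<tau> # head \<tau>)) (length (body \<tau> # head \<tau>))" by (rule card_bound_set)
  then show "card_bound (predicate ` insert (body \<tau>) (set (head \<tau>))) (1 + length (head \<tau>))"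
    by (intro card_bound_subset_image[OF subset_refl]) simp
qed

context omq
begin

text \<open>Steps of two interleave the levels: \<open>ANonPath (Suc k)\<close> lies above
  \<open>ANonVia k\<close>, which lies above \<open>ANonPath k\<close>. \<open>ANonReach\<close> has
  to exceed the topmost path level, \<open>2 * levels + 4\<close>.\<close>

primrec aux_rank :: "aux_name \<Rightarrow> nat" where
  "aux_rank ADom = 1"
| "aux_rank (ADet v) = 1"
| "aux_rank (AAtom \<alpha>) = 2"
| "aux_rank (ATw y) = 2"
| "aux_rank (ANonEdge l m) = 3"
| "aux_rank (ANonPath k l m) = 2 * k + 4"
| "aux_rank (ANonVia k l n m) = 2 * k + 5"
| "aux_rank (ANonReach l m) = 2 * levels + 5"
| "aux_rank (AVar y) = 2 * levels + 6"
| "aux_rank AGoal = 2 * levels + 7"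

definition rank :: "ndl_name \<times> nat \<Rightarrow> nat" where
  "rank P = (case fst P of Sig _ \<Rightarrow> 0 | Aux i \<Rightarrow> aux_rank (from_nat i))"

lemma rank_simps [simp]: "rank (Sig S, k) = 0" "rank (Aux (to_nat a), k) = aux_rank a"
  by (simp_all add: rank_def)

lemma rank_guarded:
  assumes "1 < aux_rank a" "\<And>\<beta>. \<beta> \<in> set \<beta>s \<Longrightarrow> rank (predicate \<beta>) < aux_rank a"
    and "\<beta> \<in> set (cbody (guarded a ts \<beta>s))"
  shows "rank (predicate \<beta>) < rank (predicate (chead (guarded a ts \<beta>s)))"
  using assms by auto

lemma rank_less:
  assumes "c \<in> program" "\<beta> \<in> set (cbody c)"
  shows "rank (predicate \<beta>) < rank (predicate (chead c))"
proof -
  let ?P = "\<lambda>c. \<forall>\<beta>\<in>set (cbody c). rank (predicate \<beta>) < rank (predicate (chead c))"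
  have "?P goal_clause"
    unfolding goal_clause_def by (intro ballI, rule rank_guarded) auto
  moreover have "?P c" if "c \<in> dom_clauses \<union> det_clauses" for c
    using that unfolding dom_clauses_def det_clauses_def by auto
  moreover have "?P c" if "c \<in> atom_clauses \<union> tw_clauses" for c
    using that unfolding atom_clauses_def tw_clauses_def by (auto simp: atom.map_sel)
  moreover have "?P c" if "c \<in> edge_clauses" for c
    using that unfolding edge_clauses_def by (auto simp: conditions_def split: if_splits)
  moreover have "?P c" if "c \<in> path_clauses \<union> via_clauses \<union> reach_clauses" for c
    using that unfolding path_clauses_def via_clauses_def reach_clauses_def by auto
  ultimately show ?thesis using assms unfolding program_def by blast
qed

lemma acyclic_program: "acyclic (dependency program)"
proof -
  have "dependency program \<subseteq> (measure rank)\<inverse>"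
    unfolding dependency_def using rank_less by (auto simp: in_measure)
  moreover have "acyclic ((measure rank)\<inverse>)" by (simp add: acyclic_converse wf_acyclic)
  ultimately show ?thesis using acyclic_subset by blast
qed

lemma program_safe:
  assumes "c \<in> program"
  shows "vars (chead c) \<subseteq> (\<Union>\<beta>\<in>set (cbody c). vars \<beta>)"
proof -
  have "vars (chead (guarded a ts \<beta>s)) \<subseteq> (\<Union>\<beta>\<in>set (cbody (guarded a ts \<beta>s)). vars \<beta>)" for a ts \<beta>s
    by auto
  moreover have "(\<exists>a ts \<beta>s. c = guarded a ts \<beta>s) \<or> c \<in> dom_clauses \<union> det_clauses"
    using assms unfolding program_def goal_clause_def clauses_defs by blast
  moreover have "vars (chead c) \<subseteq> (\<Union>\<beta>\<in>set (cbody c). vars \<beta>)" if "c \<in> dom_clauses \<union> det_clauses"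
    using that unfolding dom_clauses_def det_clauses_def by auto
  ultimately show ?thesis by blast
qed

section \<open>The size of the program\<close>

lemma arity_preds: "(S, k) \<in> preds \<Longrightarrow> k \<in> {1, 2}"
  using arity_ontology_predicates arity_cq_atoms unfolding preds_def by blast

text \<open>In the bound for the body, one \<open>length vs\<close> pays for the guards, two for the
  literals of a path clause, \<open>cq_size q\<close> for the atoms in an edge clause or the goal,
  and \<open>levels\<close> for reachability. The 2 in the arity bound pays for data atoms.\<close>

definition small :: "clause \<Rightarrow> bool" where
  "small c \<longleftrightarrow> length (cbody c) \<le> 3 * length vs + cq_size q + levels + 2 \<and>
     (\<forall>\<alpha>\<in>set (chead c # cbody c). arity \<alpha> \<le> length vs + 2)"

lemma small_guarded:
  assumes "length ts \<le> length vs" "length \<beta>s \<le> 2 * length vs + cq_size q + levels + 2"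
    and "\<And>\<beta>. \<beta> \<in> set \<beta>s \<Longrightarrow> arity \<beta> \<le> length vs + 2"
  shows "small (guarded a ts \<beta>s)"
  using assms by (auto simp: small_def)

lemma length_evs: "length evs \<le> length vs"
  by (simp add: evs_def)

lemma length_lits: "length lits \<le> 2 * length vs"
  using length_evs by (simp add: lits_def)

lemma length_answer_vars: "length (answer_vars q) \<le> length vs"
proof -
  have "distinct (answer_vars q)" "set (answer_vars q) \<subseteq> set vs" using cq by (simp_all add: is_cq_def set_vs)
  then have "length (answer_vars q) \<le> card (set vs)" by (metis List.finite_set card_mono distinct_card)
  then show ?thesis using card_length[of vs] by linarith
qed

lemma small_program:
  assumes "c \<in> program"
  shows "small c"
proof -
  have "small goal_clause"
  proof -
    let ?f = "filter (\<lambda>\<alpha>. vars \<alpha> \<inter> ev = {}) (cq_atoms q)"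
    have "length ?f \<le> cq_size q" unfolding cq_size_def by (rule length_filter_le)
    then have "length (map (\<lambda>y. ax (AVar y) vs) evs @ map (\<lambda>\<alpha>. ax (AAtom \<alpha>) vs) ?f)
        \<le> 2 * length vs + cq_size q + levels + 2"
      using length_evs by (simp del: set_filter)
    then show ?thesis unfolding goal_clause_def
      by (rule small_guarded[OF length_answer_vars]) auto
  qed
  moreover have "small c" if "c \<in> dom_clauses" for c
    using that unfolding dom_clauses_def by (auto simp: small_def dest!: arity_preds)
  moreover have "small c" if "c \<in> det_clauses" for c
    using that unfolding det_clauses_def
    by (auto simp: small_def detached_def dest!: arity_ontology_predicates)
  moreover have "small c" if "c \<in> atom_clauses" for c
  proof -
    have "arity \<alpha> \<le> length vs + 2" if "\<alpha> \<in> set (cq_atoms q)" for \<alpha>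
      using arity_cq_atoms[OF that] by auto
    then show ?thesis using that unfolding atom_clauses_def
      by (auto intro!: small_guarded simp: atom.map_sel)
  qed
  moreover have "small c" if "c \<in> tw_clauses" for c
    using that unfolding tw_clauses_def
    by (auto intro!: small_guarded simp: witnessed_def dest!: arity_ontology_predicates)
  moreover have "small c" if "c \<in> edge_clauses" for c
  proof -
    have "length (conditions l m) \<le> cq_size q + 1" for l m
      using length_filter_le[of _ "cq_atoms q"] by (auto simp: conditions_def cq_size_def le_SucI)
    then have "length (conditions l m) \<le> 2 * length vs + cq_size q + levels + 2" for l m
      by (rule order_trans) simp
    then show ?thesis using that unfolding edge_clauses_def by (auto intro!: small_guarded)
  qed
  moreover have "small c" if "c \<in> path_clauses \<union> via_clauses \<union> reach_clauses" for c
    using that length_lits unfolding path_clauses_def via_clauses_def reach_clauses_def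
    by (auto intro!: small_guarded)
  ultimately show ?thesis using assms unfolding program_def by blast
qed

text \<open>The summands follow the union in \<open>program\<close> and keep the shape in which
  products of index sets are counted, so that the rules for \<open>card_bound\<close> assemble them
  by unification.\<close>

lemma card_bound_program:
  assumes m: "m = cq_size q + ontology_size T" and n: "n = length vs"
  shows "card_bound program (1 + (m * 2 + n * m + (m + m) + n * m + 2 * n * (2 * n) +
    (2 * n * (2 * n) + levels * (2 * n * (2 * n))) +
    (levels * (2 * n * (2 * n * (2 * n))) + levels * (2 * n * (2 * n * (2 * n)))) +
    (2 * n * (2 * n) + n * 2)))"
proof -
  have onto: "card_bound (ontology_predicates T) m"
    using card_bound_ontology_predicates[of T] ontology card_bound_mono[of _ "ontology_size T" m]
    by (simp add: is_ontology_def m)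
  have atoms: "card_bound (set (cq_atoms q)) m"
    using card_bound_set unfolding m cq_size_def by (rule card_bound_mono) simp
  have "card_bound preds (ontology_size T + cq_size q)"
    unfolding preds_def cq_size_def using ontology
    by (intro card_bound_Un card_bound_ontology_predicates card_bound_subset_image[OF subset_refl] card_bound_set)
      (simp add: is_ontology_def)
  then have preds: "card_bound preds m" by (simp add: m add.commute)
  have vs: "card_bound (set vs) n" unfolding n by (rule card_bound_set)
  have ev: "card_bound ev n"
    using card_bound_set[of evs] length_evs card_bound_mono unfolding set_evs n by blast
  have lits: "card_bound (set lits) (2 * n)"
    using card_bound_set[of lits] length_lits card_bound_mono unfolding n by blast
  have lev: "card_bound {..<levels} levels" by (simp add: card_bound_def)
  have dom: "card_bound dom_clauses (m * 2)"
  proof (rule card_bound_subset_image[where Y = "preds \<times> {..<2::nat}"])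
    show "dom_clauses \<subseteq> (\<lambda>((S, k), i). Clause (ax ADom [i]) [Atom (Sig S) [0..<k]]) ` (preds \<times> {..<2})"
    proof
      fix c assume "c \<in> dom_clauses"
      then obtain S k i where c: "c = Clause (ax ADom [i]) [Atom (Sig S) [0..<k]]" "(S, k) \<in> preds" "i < k"
        unfolding dom_clauses_def by blast
      then show "c \<in> (\<lambda>((S, k), i). Clause (ax ADom [i]) [Atom (Sig S) [0..<k]]) ` (preds \<times> {..<2})"
        using arity_preds[of S k] by (intro image_eqI[of _ _ "((S, k), i)"]) auto
    qed
    show "card_bound (preds \<times> {..<2::nat}) (m * 2)"
      by (intro card_bound_Times preds) (simp add: card_bound_def)
  qed
  have det: "card_bound det_clauses (n * m)"
    by (rule card_bound_subset_image[OF _ card_bound_Times[OF vs onto],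
          where f = "\<lambda>(v, (S, k)). Clause (ax (ADet v) []) [Atom (Sig S) (replicate k 0)]"])
      (force simp: det_clauses_def detached_def)
  have atom: "card_bound atom_clauses (m + m)"
    unfolding atom_clauses_def
    by (intro card_bound_Un card_bound_subset_image[OF subset_refl] atoms)
  have tw: "card_bound tw_clauses (n * m)"
    by (rule card_bound_subset_image[OF _ card_bound_Times[OF ev onto],
          where f = "\<lambda>(y, (S, k)). guarded (ATw y) (map (merge y) vs) [Atom (Sig S) (replicate k y)]"])
      (force simp: tw_clauses_def witnessed_def)
  have edge: "card_bound edge_clauses (2 * n * (2 * n))"
    by (rule card_bound_subset_image[OF _ card_bound_Times[OF lits lits],
          where f = "\<lambda>(l, m). guarded (ANonEdge l m) vs (map (\<lambda>a. ax a vs) (conditions l m))"])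
      (force simp: edge_clauses_def)
  have path: "card_bound path_clauses (2 * n * (2 * n) + levels * (2 * n * (2 * n)))"
    unfolding path_clauses_def
  proof (rule card_bound_Un)
    show "card_bound {guarded (ANonPath 0 l m) vs [] | l m. l \<in> set lits \<and> m \<in> set lits \<and> l \<noteq> m} (2 * n * (2 * n))"
      by (rule card_bound_subset_image[OF _ card_bound_Times[OF lits lits],
            where f = "\<lambda>(l, m). guarded (ANonPath 0 l m) vs []"]) force
    show "card_bound {guarded (ANonPath (Suc k) l m) vs (map (\<lambda>n. ax (ANonVia k l n m) vs) lits) | k l m.
        k < levels \<and> l \<in> set lits \<and> m \<in> set lits} (levels * (2 * n * (2 * n)))"
      by (rule card_bound_subset_image[OF _ card_bound_Times[OF lev card_bound_Times[OF lits lits]],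
            where f = "\<lambda>(k, l, m). guarded (ANonPath (Suc k) l m) vs (map (\<lambda>n. ax (ANonVia k l n m) vs) lits)"]) force
  qed
  note quad = card_bound_Times[OF lev card_bound_Times[OF lits card_bound_Times[OF lits lits]]]
  have via: "card_bound via_clauses (levels * (2 * n * (2 * n * (2 * n))) + levels * (2 * n * (2 * n * (2 * n))))"
    unfolding via_clauses_def
  proof (rule card_bound_Un)
    show "card_bound {guarded (ANonVia k l n m) vs [ax (ANonPath k l n) vs] | k l n m.
        k < levels \<and> l \<in> set lits \<and> n \<in> set lits \<and> m \<in> set lits} (levels * (2 * n * (2 * n * (2 * n))))"
      by (rule card_bound_subset_image[OF _ quad,
            where f = "\<lambda>(k, l, n, m). guarded (ANonVia k l n m) vs [ax (ANonPath k l n) vs]"]) force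
    show "card_bound {guarded (ANonVia k l n m) vs [ax (ANonEdge n m) vs] | k l n m.
        k < levels \<and> l \<in> set lits \<and> n \<in> set lits \<and> m \<in> set lits} (levels * (2 * n * (2 * n * (2 * n))))"
      by (rule card_bound_subset_image[OF _ quad,
            where f = "\<lambda>(k, l, n, m). guarded (ANonVia k l n m) vs [ax (ANonEdge n m) vs]"]) force
  qed
  have reach: "card_bound reach_clauses (2 * n * (2 * n) + n * 2)"
    unfolding reach_clauses_def
  proof (rule card_bound_Un)
    show "card_bound {guarded (ANonReach l m) vs (map (\<lambda>k. ax (ANonPath k l m) vs) [0..<Suc levels]) | l m.
        l \<in> set lits \<and> m \<in> set lits} (2 * n * (2 * n))"
      by (rule card_bound_subset_image[OF _ card_bound_Times[OF lits lits],
            where f = "\<lambda>(l, m). guarded (ANonReach l m) vs (map (\<lambda>k. ax (ANonPath k l m) vs) [0..<Suc levels])"]) force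
    have "card_bound (UNIV :: bool set) 2" by (simp add: card_bound_def)
    from card_bound_Times[OF ev this]
    show "card_bound {guarded (AVar y) vs [ax (ANonReach (y, b) (y, \<not> b)) vs] | y b. y \<in> ev} (n * 2)"
      by (rule card_bound_subset_image[rotated,
            where f = "\<lambda>(y, b). guarded (AVar y) vs [ax (ANonReach (y, b) (y, \<not> b)) vs]"]) force
  qed
  have goal: "card_bound {goal_clause} 1" by (simp add: card_bound_def)
  have "program = {goal_clause} \<union> (dom_clauses \<union> det_clauses \<union> atom_clauses \<union> tw_clauses \<union> edge_clauses \<union>
      path_clauses \<union> via_clauses \<union> reach_clauses)"
    by (simp add: program_def)
  then show ?thesis
    by (simp only:) (intro card_bound_Un goal dom det atom tw edge path via reach)
qed

lemma length_vs: "length vs \<le> 2 * cq_size q"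
proof -
  have "length (concat (map args (cq_atoms q))) \<le> 2 * length (cq_atoms q)"
  proof -
    have "(\<Sum>\<alpha>\<leftarrow>cq_atoms q. arity \<alpha>) \<le> (\<Sum>\<alpha>\<leftarrow>cq_atoms q. 2)"
      using arity_cq_atoms by (intro sum_list_mono) force
    then show ?thesis by (simp add: length_concat comp_def sum_list_triv)
  qed
  then show ?thesis using length_remdups_leq[of "concat (map args (cq_atoms q))"]
    unfolding vs_def cq_size_def by linarith
qed

text \<open>The exponent is 5 + 7. With \<open>b\<close> the base, a clause has at most
  \<open>8 * b\<^sup>2\<close> atoms of size at most \<open>b\<close>. There are at most
  \<open>16 * b ^ 5\<close> clauses, the order being that of \<open>via_clauses\<close>:
  \<open>b\<^sup>2\<close> levels times three literals.\<close>

lemma ndl_size_program: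
  "ndl_size program \<le> (4 * (cq_size q + ontology_size T) + 4) ^ 12"
proof -
  define m n where "m = cq_size q + ontology_size T" and "n = length vs"
  \<comment> \<open>\<open>2 * n\<close> is at most \<open>4 * m\<close> because an atom has at most
    two variables; the added 4 gives \<open>16 \<le> b\<^sup>2\<close>, so that a factor
    \<open>b\<^sup>2\<close> absorbs the constants 8 and 16.\<close>
  define b where "b = 4 * m + 4"
  have n: "2 * n \<le> b" "n + 3 \<le> b" using length_vs by (auto simp: b_def m_def n_def)
  have b: "4 \<le> b" "m \<le> b" "cq_size q \<le> b" by (auto simp: b_def m_def)
  have lev: "levels \<le> b\<^sup>2" unfolding levels_def n_def[symmetric] using n(1) by (rule power_mono) simp
  have b16: "16 \<le> b\<^sup>2" using power_mono[OF b(1), of 2] by simp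
  have pow: "b ^ i \<le> b ^ j" if "i \<le> j" for i j using that b(1) by (intro power_increasing) auto
  have size: "(\<Sum>\<alpha>\<leftarrow>chead c # cbody c. 1 + arity \<alpha>) \<le> b ^ 5" if "c \<in> program" for c
  proof -
    have s: "length (cbody c) \<le> 3 * n + cq_size q + levels + 2"
      "\<And>\<alpha>. \<alpha> \<in> set (chead c # cbody c) \<Longrightarrow> arity \<alpha> \<le> n + 2"
      using small_program[OF that] unfolding small_def n_def by blast+
    have "(\<Sum>\<alpha>\<leftarrow>chead c # cbody c. 1 + arity \<alpha>) \<le> length (chead c # cbody c) * (1 + (n + 2))"
      using s(2) by (rule sum_list_arity_le)
    also have "\<dots> \<le> (8 * b\<^sup>2) * b"
    proof (rule mult_mono)
      have "length (chead c # cbody c) \<le> 3 * b + b + b\<^sup>2 + 3 * b" using s(1) n lev b by simp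
      also have "\<dots> \<le> 8 * b\<^sup>2" using pow[of 1 2] by simp
      finally show "length (chead c # cbody c) \<le> 8 * b\<^sup>2" .
    qed (use n in auto)
    also have "\<dots> \<le> (b\<^sup>2 * b\<^sup>2) * b" using b16 by (intro mult_right_mono) auto
    also have "\<dots> = b ^ 5" by (simp add: numeral_eq_Suc)
    finally show ?thesis .
  qed
  have card: "finite program" "card program \<le> b ^ 7"
  proof -
    note cb = card_bound_program[OF m_def n_def]
    then show "finite program" by (simp add: card_bound_def)
    define x where "x = 2 * n"
    have x: "x \<le> b" using n by (simp add: x_def)
    have p: "y * z \<le> b ^ (i + j)" if "y \<le> b ^ i" "z \<le> b ^ j" for y z i j
      using mult_mono[OF that] by (simp add: power_add)
    have x1: "x \<le> b ^ 1" and m1: "m \<le> b ^ 1" and n1: "n \<le> b ^ 1" using x b n by auto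
    have nm: "n * m \<le> b ^ 5" using p[OF n1 m1] pow[of "1 + 1" 5] by linarith
    have x2: "x * x \<le> b ^ 2" using p[OF x1 x1] by (simp add: power2_eq_square)
    have x3: "x * (x * x) \<le> b ^ 3" using p[OF x1 x2] by (simp add: power2_eq_square power3_eq_cube mult.assoc)
    have l2: "levels * (x * x) \<le> b ^ 5" using p[OF lev x2] pow[of "2 + 2" 5] by linarith
    have l3: "levels * (x * (x * x)) \<le> b ^ 5" using p[OF lev x3] by simp
    have b5: "b \<le> b ^ 5" "b ^ 2 \<le> b ^ 5" "1 \<le> b ^ 5" using pow[of 1 5] pow[of 2 5] pow[of 0 5] by auto
    have "card program \<le> 1 + (m * 2 + n * m + (m + m) + n * m + x * x + (x * x + levels * (x * x)) +
      (levels * (x * (x * x)) + levels * (x * (x * x))) + (x * x + n * 2))"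
      using cb unfolding card_bound_def x_def by simp
    also have "\<dots> \<le> 16 * b ^ 5"
      using nm x2 l2 l3 b5 b(2) n(1) by linarith
    also have "\<dots> \<le> b\<^sup>2 * b ^ 5" using b16 by (rule mult_right_mono) simp
    also have "\<dots> = b ^ 7" by (simp flip: power_add)
    finally show "card program \<le> b ^ 7" .
  qed
  have "ndl_size program \<le> (\<Sum>c\<in>program. b ^ 5)"
    unfolding ndl_size_def using size by (rule sum_mono)
  also have "\<dots> = card program * b ^ 5" by simp
  also have "\<dots> \<le> b ^ 7 * b ^ 5" using card(2) by (rule mult_right_mono) simp
  also have "\<dots> = b ^ 12" by (simp flip: power_add)
  finally show ?thesis by (simp add: b_def m_def)
qed

lemma is_ndl_program: "is_ndl program"
  using card_bound_program[OF refl refl] acyclic_program program_safe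
  unfolding is_ndl_def card_bound_def by blast

end

text \<open>Depth 1 enters through \<open>match_complete\<close>, in the direction from entailment
  to derivation; the converse is evaluation in the intended model.\<close>

lemma (in depth_one_omq) ndl_rewriting_program: "ndl_rewriting q T program (Aux (to_nat AGoal))"
  unfolding ndl_rewriting_def
proof (intro conjI allI impI)
  show "is_ndl program" by (rule is_ndl_program)
next
  fix A as
  assume "finite A \<and> complete_for T A \<and> set as \<subseteq> ind A \<and> length as = length (answer_vars q)"
  then have complete: "complete_for T A" by blast
  show "entails_cq T A q as \<longleftrightarrow> datalog_entails program A (Atom (Aux (to_nat AGoal)) as)"
  proof
    assume "entails_cq T A q as"
    from match_complete[OF complete this] obtain g I where g: "map g (answer_vars q) = as" "match A g I"
      "\<And>v. v \<in> set vs \<Longrightarrow> \<exists>S bs. (S, length bs) \<in> preds \<and> Atom S bs \<in> A \<and> g v \<in> set bs"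
      unfolding preds_def by blast
    have sat: "satisfiable A g" using g(2) match_iff_satisfiable by blast
    show "datalog_entails program A (Atom (Aux (to_nat AGoal)) as)"
      unfolding datalog_entails_def
    proof (intro allI impI, elim conjE)
      fix N :: "(ndl_name, nat) interp"
      assume "is_interp N" "\<forall>c\<in>program. sat_clause N c" "sat_data N (map_atom Sig id ` A)"
      from program_derives[OF this g(3) sat] show "holds N (Con N) (Atom (Aux (to_nat AGoal)) as)"
        using g(1) by (simp add: ax_def)
    qed
  qed (rule program_sound)
qed

theorem theorem9:
  shows "\<exists>p :: nat poly. \<forall>q T. is_cq q \<and> is_ontology T \<and> of_depth T 1 \<longrightarrow>
    (\<exists>\<Pi> G. ndl_rewriting q T \<Pi> G \<and> ndl_size \<Pi> \<le> poly p (cq_size q + ontology_size T))"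
proof (intro exI[of _ "[:4, 4:] ^ 12"] allI impI, elim conjE)
  fix q T
  assume "is_cq q" "is_ontology T" "of_depth T 1"
  then interpret depth_one_omq q T by unfold_locales
  have "ndl_size program \<le> poly ([:4, 4:] ^ 12) (cq_size q + ontology_size T)"
    using ndl_size_program by (simp add: algebra_simps)
  then show "\<exists>\<Pi> G. ndl_rewriting q T \<Pi> G \<and>
      ndl_size \<Pi> \<le> poly ([:4, 4:] ^ 12) (cq_size q + ontology_size T)"
    using ndl_rewriting_program by blast
qed

end
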